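(* There exist a complex surface $X$ (a complex manifold of complex dimension two) and a holomorphic submersion $\pi$ of $X$ onto the unit disk $\Delta\subset\mathbb{C}$, with fibers $X_z:=\pi^{-1}(z)$, such that: (1) every fiber $X_z$, $z\in\Delta$, is a disk with possible punctures; (2) the fiber $X_0$ over the origin is a punctured disk; and the subset $U\subset\Delta$ consisting of those $z$ for which the fiber $X_z$ is a disk is nonempty and open, and $0\in\partial U$; (3) for any circle $\gamma_0$ around the puncture in $X_0$, any $a\in U$ and any circle $\gamma_a$ in $X_a$, there do not exist $\varepsilon\in(0,1)$ and a foliated holomorphic map $f:H_\varepsilon\to X$ such that $f(\{0\}\times\Delta)\subset X_a$, $f(\mathbb{S}^1_1)\subset X_0$, and $f(\mathbb{S}^1_1)$ is homologous to $\gamma_0$ in the fiber $X_0$.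
   Context: $\Delta_r=\{z\in\mathbb{C}:|z|<r\}$, $\Delta=\Delta_1$, and $A_{r_1}^{r_2}=\Delta_{r_2}\setminus\overline{\Delta_{r_1}}$ for $r_1<r_2$. For $0<\varepsilon<1$ the (thick) Hartogs figure is the domain $$H_\varepsilon=(\Delta_\varepsilon\times\Delta_{1+\varepsilon})\cup(\Delta_{1+\varepsilon}\times A_{1-\varepsilon}^{1+\varepsilon})\subset\mathbb{C}^2,$$ with the standard complex structure; $\pi_1:(z,w)\mapsto z$ is its projection to the first factor, whose image is $\Delta_{1+\varepsilon}$. For a point $a$, $\mathbb{S}^1_a=\{a\}\times\{|w|=1\}\subset\mathbb{C}^2$; in particular $\mathbb{S}^1_1=\{1\}\times\{|w|=1\}\subset H_\varepsilon$. A holomorphic map $f:H_\varepsilon\to X$ is called foliated if there is a holomorphic map $\zeta:\Delta_{1+\varepsilon}\to\Delta$ with $\pi(f(z,w))=\zeta(z)$ for all $(z,w)\in H_\varepsilon$. "A disk" means a Riemann surface biholomorphic to $\Delta$; "a punctured disk" means one biholomorphic to $\Delta\setminus\{0\}$; "a disk with possible punctures" means one biholomorphic to $\Delta$ minus a (possibly empty) closed discrete set of points. A circle in a fiber is a diffeomorphic image of the unit circle $\{|w|=1\}$; a circle around the puncture in $X_0$ is such a circle winding once around the puncture, i.e. representing a generator of $H_1(X_0,\mathbb{Z})$. The set $f(\mathbb{S}^1_1)$ is regarded as the 1-cycle $\theta\mapsto f(1,e^{i\theta})$. *)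

theory Defs
  imports "HOL-Analysis.Analysis" "HOL-Homology.Homology"
begin

section \<open>Holomorphic functions of two complex variables\<close>

definition holomorphic2_on :: "(complex \<times> complex \<Rightarrow> complex) \<Rightarrow> (complex \<times> complex) set \<Rightarrow> bool"
    (infixl "holomorphic2'_on" 50)
  where "f holomorphic2_on S \<longleftrightarrow>
    (\<forall>p\<in>S. \<exists>A B. (f has_derivative (\<lambda>(h, k). A * h + B * k)) (at p within S))"

definition holomorphic_C2_on ::
    "(complex \<times> complex \<Rightarrow> complex \<times> complex) \<Rightarrow> (complex \<times> complex) set \<Rightarrow> bool"
    (infixl "holomorphic'_C2'_on" 50)
  where "F holomorphic_C2_on S \<longleftrightarrow>
    (fst \<circ> F) holomorphic2_on S \<and> (snd \<circ> F) holomorphic2_on S"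


section \<open>Complex manifolds\<close>

text \<open>A chart is a pair of its domain and the coordinate map (whose values outside the domain are
  irrelevant). The model space \<open>'m\<close> is \<open>complex\<close> or \<open>complex \<times> complex\<close>, and \<open>hol\<close> is
  the corresponding notion of holomorphic self-map of the model space.\<close>

type_synonym ('a, 'm) chart = "'a set \<times> ('a \<Rightarrow> 'm)"

definition is_chart :: "'a topology \<Rightarrow> ('a, 'm::topological_space) chart \<Rightarrow> bool"
  where "is_chart X = (\<lambda>(V, \<phi>). openin X V \<and> open (\<phi> ` V) \<and>
    homeomorphic_map (subtopology X V) (top_of_set (\<phi> ` V)) \<phi>)"

definition compatible_charts ::
    "(('m \<Rightarrow> 'm) \<Rightarrow> 'm set \<Rightarrow> bool) \<Rightarrow> ('a, 'm) chart \<Rightarrow> ('a, 'm) chart \<Rightarrow> bool"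
  where "compatible_charts hol = (\<lambda>(V, \<phi>) (W, \<psi>).
    hol (\<psi> \<circ> inv_into V \<phi>) (\<phi> ` (V \<inter> W)) \<and> hol (\<phi> \<circ> inv_into W \<psi>) (\<psi> ` (V \<inter> W)))"

definition complex_manifold ::
    "(('m \<Rightarrow> 'm) \<Rightarrow> 'm set \<Rightarrow> bool) \<Rightarrow> 'a topology \<Rightarrow> ('a, 'm::topological_space) chart set \<Rightarrow> bool"
  where "complex_manifold hol X \<A> \<longleftrightarrow>
    Hausdorff_space X \<and> second_countable X \<and>
    (\<forall>c\<in>\<A>. is_chart X c) \<and> (\<Union>c\<in>\<A>. fst c) = topspace X \<and>
    (\<forall>c\<in>\<A>. \<forall>d\<in>\<A>. compatible_charts hol c d)"

definition maximal_atlas ::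
    "(('m \<Rightarrow> 'm) \<Rightarrow> 'm set \<Rightarrow> bool) \<Rightarrow> 'a topology \<Rightarrow> ('a, 'm::topological_space) chart set
      \<Rightarrow> ('a, 'm) chart set"
  where "maximal_atlas hol X \<A> = {c. is_chart X c \<and> (\<forall>d\<in>\<A>. compatible_charts hol c d)}"

text \<open>A complex surface has at most the cardinality of the continuum, so every complex surface is
  isomorphic to one whose points lie in a given type of that cardinality, such as
  \<open>complex \<times> complex\<close>. Existence over such a carrier type is thus no restriction; the topology of
  the surface is the argument \<open>X\<close> and need not come from that of the carrier type.\<close>

definition complex_surface :: "'a topology \<Rightarrow> ('a, complex \<times> complex) chart set \<Rightarrow> bool"
  where "complex_surface X \<A> \<longleftrightarrow> complex_manifold (holomorphic_C2_on) X \<A>"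

definition riemann_surface :: "'a topology \<Rightarrow> ('a, complex) chart set \<Rightarrow> bool"
  where "riemann_surface T \<B> \<longleftrightarrow> complex_manifold (holomorphic_on) T \<B> \<and> connected_space T"


section \<open>Holomorphic maps, submersions and their fibers\<close>

text \<open>A holomorphic map from an open subset \<open>W\<close> of \<open>\<complex>\<^sup>2\<close> to a complex surface.\<close>

definition holomorphic_to_surface ::
    "'a topology \<Rightarrow> ('a, complex \<times> complex) chart set \<Rightarrow> (complex \<times> complex) set
      \<Rightarrow> (complex \<times> complex \<Rightarrow> 'a) \<Rightarrow> bool"
  where "holomorphic_to_surface X \<A> W f \<longleftrightarrow>
    continuous_map (top_of_set W) X f \<and>
    (\<forall>(V, \<phi>)\<in>\<A>. (\<phi> \<circ> f) holomorphic_C2_on (W \<inter> f -` V))"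

text \<open>The derivative in every chart is complex linear (holomorphy) and surjective (submersion).\<close>

definition holomorphic_submersion ::
    "'a topology \<Rightarrow> ('a, complex \<times> complex) chart set \<Rightarrow> ('a \<Rightarrow> complex) \<Rightarrow> bool"
  where "holomorphic_submersion X \<A> \<pi> \<longleftrightarrow>
    (\<forall>(V, \<phi>)\<in>\<A>. \<forall>p\<in>\<phi> ` V. \<exists>A B.
      ((\<pi> \<circ> inv_into V \<phi>) has_derivative (\<lambda>(h, k). A * h + B * k)) (at p) \<and>
      surj (\<lambda>(h, k). A * h + B * k))"

definition fiber :: "'a topology \<Rightarrow> ('a \<Rightarrow> complex) \<Rightarrow> complex \<Rightarrow> 'a set"
  where "fiber X \<pi> z = {x \<in> topspace X. \<pi> x = z}"

abbreviation fiber_space :: "'a topology \<Rightarrow> ('a \<Rightarrow> complex) \<Rightarrow> complex \<Rightarrow> 'a topology"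
  where "fiber_space X \<pi> z \<equiv> subtopology X (fiber X \<pi> z)"

text \<open>The submanifold structure of a fiber: the second coordinates of those charts of the surface
  in which \<open>\<pi>\<close> is the first coordinate. For a submersion such charts exist around every point.\<close>

definition fiber_atlas ::
    "'a topology \<Rightarrow> ('a, complex \<times> complex) chart set \<Rightarrow> ('a \<Rightarrow> complex) \<Rightarrow> complex
      \<Rightarrow> ('a, complex) chart set"
  where "fiber_atlas X \<A> \<pi> z =
    {(V \<inter> fiber X \<pi> z, snd \<circ> \<phi>) | V \<phi>.
      (V, \<phi>) \<in> maximal_atlas (holomorphic_C2_on) X \<A> \<and> (\<forall>x\<in>V. fst (\<phi> x) = \<pi> x)}"


section \<open>Disks and punctured disks\<close>

definition biholomorphic_to_domain :: "'a topology \<Rightarrow> ('a, complex) chart set \<Rightarrow> complex set \<Rightarrow> bool"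
  where "biholomorphic_to_domain T \<B> D \<longleftrightarrow>
    (\<exists>h. homeomorphic_map T (top_of_set D) h \<and>
      (\<forall>(V, \<psi>)\<in>\<B>. (h \<circ> inv_into V \<psi>) holomorphic_on (\<psi> ` V) \<and>
                   (\<psi> \<circ> inv_into (topspace T) h) holomorphic_on (h ` V)))"

definition is_disk :: "'a topology \<Rightarrow> ('a, complex) chart set \<Rightarrow> bool"
  where "is_disk T \<B> \<longleftrightarrow> riemann_surface T \<B> \<and> biholomorphic_to_domain T \<B> (ball 0 1)"

definition is_punctured_disk :: "'a topology \<Rightarrow> ('a, complex) chart set \<Rightarrow> bool"
  where "is_punctured_disk T \<B> \<longleftrightarrow>
    riemann_surface T \<B> \<and> biholomorphic_to_domain T \<B> (ball 0 1 - {0})"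

definition is_disk_with_possible_punctures :: "'a topology \<Rightarrow> ('a, complex) chart set \<Rightarrow> bool"
  where "is_disk_with_possible_punctures T \<B> \<longleftrightarrow> riemann_surface T \<B> \<and>
    (\<exists>P. closedin (top_of_set (ball 0 1)) P \<and> discrete P \<and>
      biholomorphic_to_domain T \<B> (ball 0 1 - P))"


section \<open>Circles in Riemann surfaces and their homology classes\<close>

definition smooth_curve_on :: "real set \<Rightarrow> (real \<Rightarrow> complex) \<Rightarrow> bool"
  where "smooth_curve_on S g \<longleftrightarrow>
    (\<exists>G :: nat \<Rightarrow> real \<Rightarrow> complex. (\<forall>t\<in>S. G 0 t = g t) \<and>
      (\<forall>n. \<forall>t\<in>S. (G n has_vector_derivative G (Suc n) t) (at t)))"

text \<open>A circle is given by a diffeomorphism from the unit circle to its image, that is, an injective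
  smooth immersion of the (compact) unit circle; only the values of \<open>\<gamma>\<close> there matter.\<close>

definition is_circle_in :: "'a topology \<Rightarrow> ('a, complex) chart set \<Rightarrow> (complex \<Rightarrow> 'a) \<Rightarrow> bool"
  where "is_circle_in T \<B> \<gamma> \<longleftrightarrow>
    continuous_map (top_of_set (sphere 0 1)) T \<gamma> \<and> inj_on \<gamma> (sphere 0 1) \<and>
    (\<forall>(V, \<psi>)\<in>\<B>. \<forall>\<theta>. \<gamma> (cis \<theta>) \<in> V \<longrightarrow>
      (\<exists>S. open S \<and> \<theta> \<in> S \<and> (\<forall>t\<in>S. \<gamma> (cis t) \<in> V) \<and>
        smooth_curve_on S (\<lambda>t. \<psi> (\<gamma> (cis t))) \<and>
        vector_derivative (\<lambda>t. \<psi> (\<gamma> (cis t))) (at \<theta>) \<noteq> 0))"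

text \<open>The singular 1-cycle \<open>\<theta> \<mapsto> \<gamma> (exp (\<i> \<theta>))\<close>, \<open>0 \<le> \<theta> \<le> 2\<pi>\<close>; the standard 1-simplex
  is parametrized by its barycentric coordinate of index 1.\<close>

definition loop_cycle :: "(complex \<Rightarrow> 'a) \<Rightarrow> 'a chain"
  where "loop_cycle \<gamma> = frag_of (restrict (\<lambda>t. \<gamma> (cis (2 * pi * t 1))) (standard_simplex 1))"

definition circle_around_puncture ::
    "'a topology \<Rightarrow> ('a, complex) chart set \<Rightarrow> (complex \<Rightarrow> 'a) \<Rightarrow> bool"
  where "circle_around_puncture T \<B> \<gamma> \<longleftrightarrow> is_circle_in T \<B> \<gamma> \<and>
    generate (homology_group 1 T) {homologous_rel_set 1 T {} (loop_cycle \<gamma>)}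
      = carrier (homology_group 1 T)"


section \<open>Hartogs figures and foliated maps\<close>

definition annulus :: "real \<Rightarrow> real \<Rightarrow> complex set"
  where "annulus r\<^sub>1 r\<^sub>2 = ball 0 r\<^sub>2 - closure (ball 0 r\<^sub>1)"

definition hartogs_figure :: "real \<Rightarrow> (complex \<times> complex) set"
  where "hartogs_figure \<epsilon> =
    (ball 0 \<epsilon> \<times> ball 0 (1 + \<epsilon>)) \<union> (ball 0 (1 + \<epsilon>) \<times> annulus (1 - \<epsilon>) (1 + \<epsilon>))"

definition foliated_map ::
    "'a topology \<Rightarrow> ('a, complex \<times> complex) chart set \<Rightarrow> ('a \<Rightarrow> complex) \<Rightarrow> real
      \<Rightarrow> (complex \<times> complex \<Rightarrow> 'a) \<Rightarrow> bool"
  where "foliated_map X \<A> \<pi> \<epsilon> f \<longleftrightarrow>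
    holomorphic_to_surface X \<A> (hartogs_figure \<epsilon>) f \<and>
    (\<exists>\<zeta>. \<zeta> holomorphic_on (ball 0 (1 + \<epsilon>)) \<and> \<zeta> ` ball 0 (1 + \<epsilon>) \<subseteq> ball 0 1 \<and>
      (\<forall>(z, w)\<in>hartogs_figure \<epsilon>. \<pi> (f (z, w)) = \<zeta> z))"

end

theory Submission
  imports Defs "HOL-Complex_Analysis.Complex_Analysis" "HOL-Real_Asymp.Real_Asymp"
begin

text \<open>Let \<open>U\<close> be a disk in the unit disk \<open>\<Delta>\<close> with \<open>0\<close> on its boundary. The surface is the bidisk without the
  points \<open>(b, 0)\<close>, \<open>b \<notin> U\<close>; over \<open>U\<close> it has its standard structure, and away from \<open>u = 0\<close> the local
  coordinates are \<open>b\<close> and \<open>u\<^sup>2 - g b\<close>. These agree because \<open>g\<close> is holomorphic on \<open>U\<close>; on \<open>\<Delta>\<close> it is only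
  continuous, and we take for it a lacunary series having \<open>\<partial>U\<close> as natural boundary.

  For a foliated map \<open>(\<zeta> z, u z w)\<close> the function \<open>u\<^sup>2 - g (\<zeta> z)\<close> is holomorphic on the Hartogs figure and
  extends to a holomorphic \<open>F z w\<close> on the bidisk. Move from \<open>z = 0\<close> to \<open>z = 1\<close> along the real segment as long
  as \<open>\<zeta> z \<in> U\<close> or the extension \<open>F + g \<circ> \<zeta>\<close> of \<open>u\<^sup>2\<close> has no zero in the disk \<open>|w| \<le> 1\<close>: so long \<open>u\<close> itself
  extends to that disk. As the circle over \<open>z = 1\<close> is not null-homologous, there is a first
  \<open>t\<close> where this fails, and just before \<open>t\<close> the values of \<open>\<zeta>\<close> lie in \<open>U\<close> and the extended \<open>u\<close> has a zero \<open>w\<close>.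
  There \<open>u\<^sup>2\<close> has derivative \<open>0\<close>, whence \<open>g' (\<zeta> z) \<zeta>' z = - \<partial>F/\<partial>z\<close> stays bounded as \<open>z \<rightarrow> t\<close>, which
  the growth of \<open>g'\<close> at \<open>\<partial>U\<close> forbids.\<close>

section \<open>Cauchy integrals depending on a parameter\<close>

text \<open>Pulled back along \<open>circlepath\<close>, this is an ordinary parameter integral over
  \<open>[0, 1]\<close>. The parameter space is an arbitrary topological space so that pairs of
  variables can serve as parameter.\<close>

lemma continuous_on_circle_integral:
  fixes F :: "'a::topological_space \<Rightarrow> complex \<Rightarrow> complex"
  assumes F: "continuous_on (S \<times> sphere a \<rho>) (\<lambda>(x, s). F x s)" and \<rho>: "0 \<le> \<rho>"
  shows "continuous_on S (\<lambda>x. contour_integral (circlepath a \<rho>) (F x))"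
proof -
  have sph: "circlepath a \<rho> t \<in> sphere a \<rho>" for t
    using \<rho> by (simp add: circlepath dist_norm norm_mult)
  have cc: "continuous_on A (circlepath a \<rho>)" for A
    unfolding circlepath by (intro continuous_intros)
  have "continuous_on (S \<times> cbox 0 1) (\<lambda>p. (\<lambda>(x, s). F x s) (fst p, circlepath a \<rho> (snd p)))"
    by (intro continuous_on_compose2[OF F] continuous_intros continuous_on_compose2[OF cc[of UNIV]])
       (auto simp: sph simp del: mem_sphere)
  then have "continuous_on (S \<times> cbox 0 1) (\<lambda>p. F (fst p) (circlepath a \<rho> (snd p)) *
      (2 * pi * \<i> * \<rho> * exp (2 * of_real pi * \<i> * snd p)))"
    by (intro continuous_on_mult) (auto simp: case_prod_unfold intro!: continuous_intros)
  then have "continuous_on S (\<lambda>x. integral (cbox 0 1) (\<lambda>t. F x (circlepath a \<rho> t) *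
      (2 * pi * \<i> * \<rho> * exp (2 * of_real pi * \<i> * t))))"
    by (intro integral_continuous_on_param) (simp add: case_prod_unfold)
  then show ?thesis
    by (simp add: contour_integral_integral vector_derivative_circlepath)
qed

text \<open>Cauchy's formula writes the derivative as an integral of \<open>F\<close> over the
  boundary circle, which inherits joint continuity from \<open>F\<close>. This supplies the
  hypothesis of the Leibniz rule below.\<close>

lemma continuous_on_deriv_param:
  fixes F :: "complex \<Rightarrow> 'b::topological_space \<Rightarrow> complex"
  assumes F: "continuous_on (cball a r \<times> T) (\<lambda>(z, t). F z t)"
    and hol: "\<And>t. t \<in> T \<Longrightarrow> (\<lambda>z. F z t) holomorphic_on ball a r" and r: "0 < r"
  shows "continuous_on (ball a r \<times> T) (\<lambda>(z, t). deriv (\<lambda>z. F z t) z)"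
proof -
  have eq: "deriv (\<lambda>z. F z t) z = contour_integral (circlepath a r) (\<lambda>s. F s t / (s - z)^2) / (2 * pi * \<i>)"
    if "z \<in> ball a r" "t \<in> T" for z t
  proof -
    have "continuous_on (cball a r) (\<lambda>s. (\<lambda>(z, t). F z t) (s, t))"
      using that by (intro continuous_on_compose2[OF F] continuous_intros) auto
    then show ?thesis
      using Cauchy_contour_integral_circlepath_2[of a r "\<lambda>z. F z t" z] hol that
      by (simp add: field_simps)
  qed
  have "continuous_on ((ball a r \<times> T) \<times> sphere a r)
      (\<lambda>q. (\<lambda>(z, t). F z t) (snd q, snd (fst q)) / (snd q - fst (fst q))^2)"
    by (intro continuous_intros continuous_on_compose2[OF F]) (auto simp: dist_norm)
  then have "continuous_on (ball a r \<times> T)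
      (\<lambda>p. contour_integral (circlepath a r) (\<lambda>s. F s (snd p) / (s - fst p)^2))"
    using r by (intro continuous_on_circle_integral) (auto simp: case_prod_unfold)
  then have "continuous_on (ball a r \<times> T)
      (\<lambda>p. contour_integral (circlepath a r) (\<lambda>s. F s (snd p) / (s - fst p)^2) / (2 * pi * \<i>))"
    by (intro continuous_intros) auto
  then show ?thesis
    by (rule continuous_on_eq) (auto simp: eq)
qed

text \<open>Differentiation under the integral sign on a small ball around each point; the
  integrand's derivative is jointly continuous by \<open>continuous_on_deriv_param\<close>.\<close>

lemma holomorphic_on_circle_integral:
  assumes F: "continuous_on (S \<times> sphere a \<rho>) (\<lambda>(z, s). F z s)" and \<rho>: "0 \<le> \<rho>"
    and hol: "\<And>s. s \<in> sphere a \<rho> \<Longrightarrow> (\<lambda>z. F z s) holomorphic_on S" and S: "open S"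
  shows "(\<lambda>z. contour_integral (circlepath a \<rho>) (F z)) holomorphic_on S"
proof -
  have sph: "circlepath a \<rho> t \<in> sphere a \<rho>" for t
    using \<rho> by (simp add: circlepath dist_norm norm_mult)
  have cc: "continuous_on A (circlepath a \<rho>)" for A
    unfolding circlepath by (intro continuous_intros)
  have "(\<lambda>z. contour_integral (circlepath a \<rho>) (F z)) field_differentiable at z0" if z0: "z0 \<in> S" for z0
  proof -
    obtain r where r: "r > 0" "cball z0 r \<subseteq> S"
      using S z0 open_contains_cball by blast
    have D: "continuous_on (ball z0 r \<times> sphere a \<rho>) (\<lambda>(z, s). deriv (\<lambda>z. F z s) z)"
      using r by (intro continuous_on_deriv_param continuous_on_subset[OF F] holomorphic_on_subset[OF hol]) auto
    define k where "k t = 2 * pi * \<i> * \<rho> * exp (2 * of_real pi * \<i> * of_real t)" for t :: real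
    have k: "continuous_on A k" for A
      unfolding k_def by (intro continuous_intros)
    have "(\<lambda>z. integral (cbox 0 1) (\<lambda>t. F z (circlepath a \<rho> t) * k t)) holomorphic_on ball z0 r"
    proof (rule leibniz_rule_holomorphic[where fx = "\<lambda>z t. deriv (\<lambda>z. F z (circlepath a \<rho> t)) z * k t"])
      fix z t assume z: "z \<in> ball z0 r"
      then have "(\<lambda>z. F z (circlepath a \<rho> t)) field_differentiable at z"
        using r by (intro holomorphic_on_imp_differentiable_at[OF hol S] sph) auto
      then show "((\<lambda>z. F z (circlepath a \<rho> t) * k t) has_field_derivative
          deriv (\<lambda>z. F z (circlepath a \<rho> t)) z * k t) (at z within ball z0 r)"
        using field_differentiable_derivI has_field_derivative_at_within DERIV_cmult_right by blast
    next
      fix z assume "z \<in> ball z0 r"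
      then have "continuous_on (cbox 0 1) (\<lambda>t. (\<lambda>(z, s). F z s) (z, circlepath a \<rho> t))"
        using r sph by (intro continuous_on_compose2[OF F] continuous_intros cc) auto
      then show "(\<lambda>t. F z (circlepath a \<rho> t) * k t) integrable_on cbox 0 1"
        by (intro integrable_continuous continuous_intros k) auto
    next
      have "continuous_on (ball z0 r \<times> cbox 0 1)
          (\<lambda>p. (\<lambda>(z, s). deriv (\<lambda>z. F z s) z) (fst p, circlepath a \<rho> (snd p)) * k (snd p))"
        by (intro continuous_intros continuous_on_compose2[OF D] continuous_on_compose2[OF cc[of UNIV]]
            continuous_on_compose2[OF k[of UNIV]]) (auto simp: sph simp del: mem_sphere)
      then show "continuous_on (ball z0 r \<times> cbox 0 1)
          (\<lambda>(z, t). deriv (\<lambda>z. F z (circlepath a \<rho> t)) z * k t)"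
        by (simp add: case_prod_unfold)
    qed auto
    then show ?thesis
      using r by (simp add: contour_integral_integral vector_derivative_circlepath k_def
          holomorphic_on_imp_differentiable_at)
  qed
  then show ?thesis
    by (simp add: holomorphic_on_def field_differentiable_at_within)
qed

text \<open>Only the values of \<open>f\<close> on the circle enter. A function given on an annulus
  thus has a candidate for its extension to the disk, whether or not an extension exists.\<close>

definition cauchy_integral :: "real \<Rightarrow> (complex \<Rightarrow> complex) \<Rightarrow> complex \<Rightarrow> complex"
  where "cauchy_integral \<rho> f w = contour_integral (circlepath 0 \<rho>) (\<lambda>s. f s / (s - w)) / (2 * pi * \<i>)"

lemma cauchy_integral_eq:
  assumes "continuous_on (cball 0 \<rho>) f" "f holomorphic_on ball 0 \<rho>" "w \<in> ball 0 \<rho>"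
  shows "cauchy_integral \<rho> f w = f w"
  using contour_integral_unique[OF Cauchy_integral_circlepath[of 0 \<rho> f w]] assms
  by (simp add: cauchy_integral_def field_simps)

lemma continuous_on_cauchy_integral:
  assumes F: "continuous_on (S \<times> sphere 0 \<rho>) (\<lambda>(z, s). F z s)" and \<rho>: "0 \<le> \<rho>"
  shows "continuous_on (S \<times> ball 0 \<rho>) (\<lambda>(z, w). cauchy_integral \<rho> (F z) w)"
proof -
  have "continuous_on ((S \<times> ball 0 \<rho>) \<times> sphere 0 \<rho>)
      (\<lambda>q. (\<lambda>(z, s). F z s) (fst (fst q), snd q) / (snd q - snd (fst q)))"
    by (intro continuous_intros continuous_on_compose2[OF F]) auto
  then have "continuous_on (S \<times> ball 0 \<rho>) (\<lambda>p. contour_integral (circlepath 0 \<rho>)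
      (\<lambda>s. F (fst p) s / (s - snd p)))"
    using \<rho> by (intro continuous_on_circle_integral) (auto simp: case_prod_unfold)
  then show ?thesis
    unfolding cauchy_integral_def case_prod_unfold by (intro continuous_intros) auto
qed

lemma holomorphic_on_cauchy_integral:
  assumes "continuous_on (sphere 0 \<rho>) f"  and \<rho>: "0 \<le> \<rho>"
  shows "cauchy_integral \<rho> f holomorphic_on ball 0 \<rho>"
proof -
  have "continuous_on (ball 0 \<rho> \<times> sphere 0 \<rho>) (\<lambda>q. f (snd q) / (snd q - fst q))"
    by (intro continuous_intros continuous_on_compose2[OF assms(1)]) auto
  then have "(\<lambda>w. contour_integral (circlepath 0 \<rho>) (\<lambda>s. f s / (s - w))) holomorphic_on ball 0 \<rho>"
    using \<rho> by (intro holomorphic_on_circle_integral holomorphic_intros) (auto simp: case_prod_unfold)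
  then show ?thesis
    unfolding cauchy_integral_def by (intro holomorphic_intros) auto
qed

lemma holomorphic_on_cauchy_integral_param:
  assumes F: "continuous_on (S \<times> sphere 0 \<rho>) (\<lambda>(z, s). F z s)" and \<rho>: "0 \<le> \<rho>" and S: "open S"
    and hol: "\<And>s. s \<in> sphere 0 \<rho> \<Longrightarrow> (\<lambda>z. F z s) holomorphic_on S" and w: "w \<in> ball 0 \<rho>"
  shows "(\<lambda>z. cauchy_integral \<rho> (F z) w) holomorphic_on S"
proof -
  have "continuous_on (S \<times> sphere 0 \<rho>) (\<lambda>q. (\<lambda>(z, s). F z s) q / (snd q - w))"
    using w by (intro continuous_intros F) auto
  moreover have "(\<lambda>z. F z s / (s - w)) holomorphic_on S" if "s \<in> sphere 0 \<rho>" for s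
    using that w by (intro holomorphic_intros hol) auto
  ultimately have "(\<lambda>z. contour_integral (circlepath 0 \<rho>) (\<lambda>s. F z s / (s - w))) holomorphic_on S"
    using \<rho> S by (intro holomorphic_on_circle_integral) (auto simp: case_prod_unfold)
  then show ?thesis
    unfolding cauchy_integral_def by (intro holomorphic_intros) auto
qed

section \<open>A lacunary series with rapidly growing derivative\<close>

text \<open>The coefficients make the series converge uniformly on the closed disk; the gap ratio
  100 lets one term dominate the derivative on suitable circles.\<close>

definition lacunary :: "complex \<Rightarrow> complex"
  where "lacunary b = suminf (\<lambda>k. b ^ (100 ^ k) / of_nat (Suc k) ^ 2)"

lemma summable_inverse_Suc_squares: "summable (\<lambda>k. 1 / real (Suc k) ^ 2)"
  using inverse_power_summable[of 2, where ?'a = real] summable_Suc_iff[of "\<lambda>n. inverse (real n ^ 2)"]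
  by (simp add: divide_inverse)

lemma norm_lacunary_term_le:
  fixes b :: complex
  shows "norm b \<le> 1 \<Longrightarrow> norm (b ^ (100 ^ k) / of_nat (Suc k) ^ 2) \<le> 1 / real (Suc k) ^ 2"
  by (simp add: norm_divide norm_power power_le_one divide_right_mono del: of_nat_Suc)

lemma continuous_on_lacunary: "continuous_on (cball 0 1) lacunary"
proof (rule uniform_limit_theorem)
  show "uniform_limit (cball 0 1) (\<lambda>n b. \<Sum>k<n. b ^ (100 ^ k) / of_nat (Suc k) ^ 2) lacunary sequentially"
    unfolding lacunary_def
    by (rule Weierstrass_m_test[OF norm_lacunary_term_le summable_inverse_Suc_squares]) auto
qed (auto intro!: always_eventually continuous_intros simp del: of_nat_Suc)

text \<open>Termwise differentiation: the majorant of the series holds on the whole open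
  disk.\<close>

lemma lacunary_deriv_sums:
  assumes "b \<in> ball 0 1"
  shows "lacunary field_differentiable at b"
    and "(\<lambda>k. 100 ^ k * b ^ (100 ^ k - 1) / of_nat (Suc k) ^ 2) sums deriv lacunary b"
proof -
  define f f' :: "nat \<Rightarrow> complex \<Rightarrow> complex"
    where "f = (\<lambda>k b. b ^ (100 ^ k) / of_nat (Suc k) ^ 2)"
      and "f' = (\<lambda>k b. 100 ^ k * b ^ (100 ^ k - 1) / of_nat (Suc k) ^ 2)"
  have d: "(f k has_field_derivative f' k x) (at x)" for k x
    unfolding f_def f'_def by (rule DERIV_cdivide) (auto intro!: derivative_eq_intros)
  have e: "\<forall>\<^sub>F k in sequentially. \<forall>x \<in> ball 0 1. norm (f k x) \<le> 1 / real (Suc k) ^ 2"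
    unfolding f_def by (intro always_eventually allI ballI norm_lacunary_term_le) simp
  obtain g g' where g: "\<forall>x \<in> ball 0 1. ((\<lambda>k. f k x) sums g x) \<and> ((\<lambda>k. f' k x) sums g' x) \<and>
      (g has_field_derivative g' x) (at x)"
    by (rule series_and_derivative_comparison[OF open_ball summable_inverse_Suc_squares d e])
  have "g x = lacunary x" if "x \<in> ball 0 1" for x
    using that g sums_unique[of "\<lambda>k. f k x"] unfolding lacunary_def f_def by auto
  then have "(lacunary has_field_derivative g' b) (at b)"
    using has_field_derivative_transform_within_open[of g "g' b" b "ball 0 1" lacunary] g assms by auto
  then show "lacunary field_differentiable at b"
    "(\<lambda>k. 100 ^ k * b ^ (100 ^ k - 1) / of_nat (Suc k) ^ 2) sums deriv lacunary b"
    using g assms by (auto simp: field_differentiable_def DERIV_imp_deriv f'_def)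
qed

section \<open>Series dominated by a single term\<close>

lemma sums_split_at:
  fixes f :: "nat \<Rightarrow> 'a::real_normed_vector"
  assumes "f sums s"
  shows "(\<lambda>k. f (k + Suc n)) sums (s - f n - (\<Sum>k<n. f k))"
  using sums_split_initial_segment[OF assms, of "Suc n"] by (simp add: algebra_simps)

text \<open>The terms before and after the \<open>n\<close>-th are each bounded by the geometric
  series \<open>A * (1/25 + 1/25^2 + ...) = A / 24\<close>, together \<open>A / 12\<close>.\<close>

lemma sums_norm_term_le:
  fixes f :: "nat \<Rightarrow> complex"
  assumes s: "f sums s" and A: "0 \<le> A"
    and low: "\<And>k. k < n \<Longrightarrow> norm (f k) \<le> A * (1/25) ^ (n - k)"
    and up: "\<And>k. norm (f (k + Suc n)) \<le> A * (1/25) ^ Suc k"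
  shows "norm (f n) \<le> norm s + A / 12"
proof -
  have geo: "(\<lambda>k. A * (1/25::real) ^ Suc k) sums (A * (1/24))"
    using sums_mult[OF sums_mult[OF geometric_sums[of "1/25::real"], of "1/25"], of A] by simp
  have "norm (\<Sum>k<n. f k) \<le> (\<Sum>k<n. A * (1/25) ^ (n - k))"
    using low by (intro sum_norm_le) auto
  also have "\<dots> = (\<Sum>k<n. A * (1/25) ^ Suc k)"
    by (rule sum.reindex_bij_witness[of _ "\<lambda>k. n - Suc k" "\<lambda>k. n - Suc k"]) (auto simp: Suc_diff_Suc)
  also have "\<dots> \<le> A * (1/24)"
    using sum_le_suminf[of "\<lambda>k. A * (1/25::real) ^ Suc k" "{..<n}"] geo A
    by (simp add: sums_iff)
  finally have 1: "norm (\<Sum>k<n. f k) \<le> A / 24" by simp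
  have "norm (s - f n - (\<Sum>k<n. f k)) \<le> A * (1/24)"
    using sums_split_at[OF s, of n] geo up
    by (metis (no_types, lifting) norm_sums_le)
  with 1 show ?thesis
    by norm
qed

text \<open>On the circle of radius \<open>1 - 100\<^sup>-\<^sup>n\<close> the \<open>n\<close>-th term of the series of \<open>b lacunary' b\<close> outweighs
  all others together.\<close>

lemma lacunary_deriv_lower_bound:
  assumes n: "n \<noteq> 0" and b: "norm b = 1 - 1 / 100 ^ n"
  shows "100 ^ n / (6 * real (Suc n) ^ 2) \<le> norm (deriv lacunary b)"
proof -
  define m :: nat where "m = 100 ^ n"
  define x where "x = norm b"
  define A where "A = real m / real (Suc n) ^ 2"
  \<comment> \<open>The factor \<open>b\<close> turns the exponent \<open>100 ^ k - 1\<close> into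
    \<open>100 ^ k\<close>; it is dropped at the end because \<open>norm b < 1\<close>.\<close>
  define f where "f k = b * (100 ^ k * b ^ (100 ^ k - 1) / of_nat (Suc k) ^ 2)" for k
  have A: "0 \<le> A" by (simp add: A_def)
  have m: "m \<ge> 100" using n unfolding m_def by (cases n) auto
  have x: "x = 1 - 1 / m" "0 \<le> x" "x < 1"
    using m by (auto simp: x_def m_def b)
  have bb: "b \<in> ball 0 1" using x by (simp add: x_def)
  have nf: "norm (f k) = 100 ^ k * x ^ (100 ^ k) / real (Suc k) ^ 2" for k
  proof -
    have "x ^ (100 ^ k) = x * x ^ (100 ^ k - 1)"
      by (metis power_eq_0_iff power_minus_mult zero_less_numeral zero_less_power mult.commute)
    then show ?thesis
      by (simp add: f_def norm_mult norm_divide norm_power x_def del: of_nat_Suc)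
  qed
  have low: "norm (f k) \<le> A * (1/25) ^ (n - k)" if "k < n" for k
  proof -
    obtain j where j: "n = k + j" using \<open>k < n\<close> less_imp_add_positive by blast
    \<comment> \<open>The coefficients change by a factor of at most \<open>4 ^ j\<close> over
      \<open>j\<close> steps, against the growth \<open>100 ^ j\<close> of the exponents;
      \<open>25 ^ j\<close> remains.\<close>
    have *: "real (Suc n) \<le> real (Suc k) * 2 ^ j"
    proof -
      have "Suc j \<le> 2 ^ j" by (induction j) auto
      then have "Suc k * Suc j \<le> Suc k * 2 ^ j" by (rule mult_le_mono2)
      then have "Suc n \<le> Suc k * 2 ^ j" using j by simp
      then have "real (Suc n) \<le> real (Suc k * 2 ^ j)" by (rule of_nat_mono)
      then show ?thesis by (simp add: distrib_right)
    qed
    have power4: "((2::real) ^ j) ^ 2 = 4 ^ j"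
      by (simp add: power2_eq_square flip: power_mult_distrib)
    from * have "real (Suc n) ^ 2 \<le> (real (Suc k) * 2 ^ j) ^ 2" by (intro power_mono) auto
    then have sq: "real (Suc n) ^ 2 \<le> real (Suc k) ^ 2 * 4 ^ j"
      by (simp only: power_mult_distrib power4)
    have "norm (f k) \<le> 100 ^ k / real (Suc k) ^ 2"
      using x by (simp add: nf divide_right_mono power_le_one mult_left_le del: of_nat_Suc)
    also have "\<dots> \<le> 100 ^ k * 4 ^ j / real (Suc n) ^ 2"
      using mult_left_mono[OF sq, of "100 ^ k"] by (simp add: field_simps del: of_nat_Suc)
    also have "\<dots> = A * (1/25) ^ (n - k)"
    proof -
      have "(100::real) ^ j = 25 ^ j * 4 ^ j" by (simp flip: power_mult_distrib)
      then show ?thesis by (simp add: A_def m_def j power_add field_simps del: of_nat_Suc)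
    qed
    finally show ?thesis .
  qed
  have xm: "x ^ m \<le> exp (-1)"
    using exp_ge_one_minus_x_over_n_power_n[of 1 m] m by (simp add: x)
  \<comment> \<open>Here \<open>x ^ m\<close> is at most \<open>exp (-1)\<close>, so the power in
    the later term is at most \<open>exp (- y)\<close>. Being below \<open>2 / y ^ 2\<close>, it
    absorbs the growth factor \<open>y\<close> and leaves \<open>2 / y\<close>.\<close>
  have up: "norm (f (k + Suc n)) \<le> A * (1/25) ^ Suc k" for k
  proof -
    define y :: real where "y = 100 ^ Suc k"
    have y: "y \<ge> 100" by (simp add: y_def)
    have "x ^ (100 ^ (k + Suc n)) = (x ^ m) ^ (100 ^ Suc k)"
      by (simp add: m_def power_add mult_ac flip: power_mult)
    also have "\<dots> \<le> exp (-1) ^ (100 ^ Suc k)"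
      using xm x by (intro power_mono) auto
    also have "\<dots> = exp (- y)"
      using exp_of_nat_mult[of "100 ^ Suc k" "-1::real"] by (simp add: y_def)
    also have "\<dots> \<le> 2 / y ^ 2"
    proof -
      have "y ^ 2 / 2 \<le> exp y"
        using exp_lower_Taylor_quadratic[of y] y by simp
      then show ?thesis using y by (simp add: exp_minus field_simps)
    qed
    finally have xx: "x ^ (100 ^ (k + Suc n)) \<le> 2 / y ^ 2" .
    have "norm (f (k + Suc n)) = m * y * x ^ (100 ^ (k + Suc n)) / real (Suc (k + Suc n)) ^ 2"
      by (simp add: nf m_def y_def power_add)
    also have "\<dots> \<le> m * y * x ^ (100 ^ (k + Suc n)) / real (Suc n) ^ 2"
      using x y by (intro divide_left_mono power_mono) auto
    also have "\<dots> \<le> m * y * (2 / y ^ 2) / real (Suc n) ^ 2"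
      using xx y by (intro divide_right_mono mult_left_mono) auto
    also have "\<dots> = A * (2 / y)"
      using y by (simp add: A_def power2_eq_square)
    also have "\<dots> \<le> A * (1/25) ^ Suc k"
    proof (rule mult_left_mono)
      have "(2::real) \<le> 4 ^ Suc k"
        using one_le_power[of "4::real" k] by (simp, linarith)
      then have "2 * (1/100) ^ Suc k \<le> (4::real) ^ Suc k * (1/100) ^ Suc k"
        by (intro mult_right_mono) auto
      also have "\<dots> = (1/25) ^ Suc k"
        unfolding power_mult_distrib[symmetric] by simp
      finally show "2 / y \<le> (1/25) ^ Suc k"
        by (simp add: y_def power_one_over power_mult_distrib power_divide)
    qed (fact A)
    finally show ?thesis .
  qed
  have "f sums (b * deriv lacunary b)"
    unfolding f_def by (intro sums_mult lacunary_deriv_sums(2) bb)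
  then have "norm (f n) \<le> norm (b * deriv lacunary b) + A / 12"
    using A low up by (rule sums_norm_term_le)
  moreover have "A / 4 \<le> norm (f n)"
  proof -
    \<comment> \<open>Bernoulli's inequality with exponent \<open>m\<close> would give only the
      bound 0. Applied to half the exponent it gives \<open>1 / 2\<close>, and squaring gives
      \<open>1 / 4\<close>.\<close>
    obtain l where l: "m = 2 * l" "l \<ge> 1"
      using m n unfolding m_def by (cases n) (auto intro!: that[of "50 * 100 ^ (n - 1)"])
    have "1 - real l * (1 / m) \<le> (1 - 1 / m) ^ l"
      using Bernoulli_inequality[of "- 1 / m" l] m by simp
    then have "1 / 2 \<le> x ^ l"
      using l by (simp add: x field_simps)
    then have "(1 / 2) ^ 2 \<le> (x ^ l) ^ 2"
      by (intro power_mono) auto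
    moreover have "x ^ m = (x ^ l) ^ 2"
      unfolding l(1) power_mult[symmetric] by (simp only: mult.commute)
    ultimately have "1 / 4 \<le> x ^ m"
      by (simp add: power_divide)
    then have "A * (1 / 4) \<le> A * x ^ m" using A by (rule mult_left_mono)
    then show ?thesis by (simp add: nf A_def m_def)
  qed
  moreover have "norm (b * deriv lacunary b) \<le> norm (deriv lacunary b)"
    using x by (simp add: norm_mult x_def[symmetric] mult_left_le_one_le)
  \<comment> \<open>Since 1/4 - 1/12 = 1/6.\<close>
  ultimately have "A / 6 \<le> norm (deriv lacunary b)" by linarith
  then show ?thesis by (simp add: A_def m_def)
qed

lemma exponential_over_power_at_top:
  "filterlim (\<lambda>n. 100 ^ n / (6 * real (Suc n) ^ 2) ^ k) at_top sequentially"
  by real_asymp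

text \<open>With \<open>k\<close> the order of \<open>\<xi> - \<xi> t1\<close> at \<open>t1\<close>, the derivative of \<open>\<xi>\<close> is comparable to
  \<open>|t - t1|\<^sup>k\<^sup>-\<^sup>1\<close> and \<open>1 - |\<xi> t| \<le> C |t - t1|\<^sup>k\<close>; on the circle of radius \<open>1 - 100\<^sup>-\<^sup>n\<close> this makes
  the composite derivative at least of order \<open>100\<^sup>n\<^sup>/\<^sup>k / n\<^sup>2\<close>. The coefficients \<open>1 / (n + 1)\<^sup>2\<close> are subexponential so
  that this is unbounded for every \<open>k\<close>.\<close>

lemma lacunary_compose_deriv_unbounded:
  fixes \<xi> :: "complex \<Rightarrow> complex" and t1 r M :: real
  assumes hol: "\<xi> holomorphic_on ball (of_real t1) r" and r: "0 < r"
    and inside: "\<And>t. t1 - r < t \<Longrightarrow> t < t1 \<Longrightarrow> norm (\<xi> (of_real t)) < 1"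
    and outside: "1 \<le> norm (\<xi> (of_real t1))"
    and bound: "\<And>t. t1 - r < t \<Longrightarrow> t < t1 \<Longrightarrow>
      norm (deriv lacunary (\<xi> (of_real t)) * deriv \<xi> (of_real t)) \<le> M"
  shows False
proof -
  let ?a = "complex_of_real t1"
  have inb: "of_real t \<in> ball ?a s" if "t1 - s < t" "t < t1" for t s
    using that by (simp add: dist_of_real dist_real_def)
  have nonconst: "\<not> (\<lambda>z. \<xi> z - \<xi> ?a) constant_on ball ?a r"
  proof
    assume "(\<lambda>z. \<xi> z - \<xi> ?a) constant_on ball ?a r"
    then obtain y where y: "\<And>z. z \<in> ball ?a r \<Longrightarrow> \<xi> z - \<xi> ?a = y"
      unfolding constant_on_def by blast
    have "\<xi> (of_real (t1 - r / 2)) = \<xi> ?a"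
      using y[of ?a] y[OF inb[of r "t1 - r / 2"]] r by simp
    then show False
      using inside[of "t1 - r / 2"] outside r by simp
  qed
  have hol': "(\<lambda>z. \<xi> z - \<xi> ?a) holomorphic_on ball ?a r" and a0: "?a \<in> ball ?a r"
    using hol r by (auto intro!: holomorphic_intros)
  obtain q r' k where k: "0 < k" and r': "0 < r'" "ball ?a r' \<subseteq> ball ?a r"
    and q: "q holomorphic_on ball ?a r'" "\<And>z. z \<in> ball ?a r' \<Longrightarrow> \<xi> z - \<xi> ?a = (z - ?a) ^ k * q z"
    and q0: "\<And>z. z \<in> ball ?a r' \<Longrightarrow> q z \<noteq> 0"
    by (rule holomorphic_factor_zero_nonconstant[OF hol' open_ball connected_ball a0 _ nonconst]) (simp, blast)
  obtain p where p: "k = Suc p" using k by (cases k) auto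
  \<comment> \<open>The cofactor of \<open>(z - ?a) ^ p\<close> in the derivative of
    \<open>(z - ?a) ^ k * q z\<close>; at \<open>?a\<close> it equals \<open>k * q ?a\<close>, which
    is nonzero.\<close>
  define B where "B z = of_nat k * q z + (z - ?a) * deriv q z" for z
  have d\<xi>: "deriv \<xi> z = (z - ?a) ^ p * B z" if z: "z \<in> ball ?a r'" for z
  proof (rule DERIV_imp_deriv)
    have "(q has_field_derivative deriv q z) (at z)"
      using q(1) z holomorphic_derivI open_ball by blast
    moreover have "((\<lambda>z. (z - ?a) ^ k) has_field_derivative of_nat k * (z - ?a) ^ p) (at z)"
    proof -
      have "((\<lambda>z. z - ?a) has_field_derivative 1) (at z)"
        by (auto intro!: derivative_eq_intros)
      then show ?thesis
        using DERIV_power[of "\<lambda>z. z - ?a" 1 z UNIV k] by (simp add: p)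
    qed
    ultimately have "((\<lambda>z. (z - ?a) ^ k * q z) has_field_derivative (z - ?a) ^ p * B z) (at z)"
      using DERIV_mult by (fastforce simp: p B_def algebra_simps)
    then have "((\<lambda>z. (z - ?a) ^ k * q z + \<xi> ?a) has_field_derivative (z - ?a) ^ p * B z) (at z)"
      using DERIV_add[OF _ DERIV_const] by force
    then show "(\<xi> has_field_derivative (z - ?a) ^ p * B z) (at z)"
      by (rule has_field_derivative_transform_within_open[OF _ open_ball z]) (simp add: q(2)[symmetric])
  qed
  have a: "?a \<in> ball ?a r'" using r' by simp
  have cq: "isCont q ?a"
    using q(1) a by (meson continuous_on_eq_continuous_at holomorphic_on_imp_continuous_on open_ball)
  moreover have cdq: "isCont (deriv q) ?a"
    using holomorphic_deriv[OF q(1) open_ball] a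
    by (meson continuous_on_eq_continuous_at holomorphic_on_imp_continuous_on open_ball)
  ultimately have cB: "isCont B ?a"
    unfolding B_def by (intro continuous_intros)
  \<comment> \<open>Half and twice the limiting values, so that strict bounds hold on a whole
    neighbourhood of \<open>?a\<close>.\<close>
  define c where "c = norm (B ?a) / 2"
  define C where "C = 2 * norm (q ?a)"
  have c: "0 < c" and C: "0 < C"
    using q0[OF a] k by (auto simp: c_def C_def B_def)
  have nB: "((\<lambda>z. norm (B z)) \<longlongrightarrow> norm (B ?a)) (nhds ?a)"
    using cB by (intro tendsto_norm) (simp add: isCont_def tendsto_at_iff_tendsto_nhds)
  have nq: "((\<lambda>z. norm (q z)) \<longlongrightarrow> norm (q ?a)) (nhds ?a)"
    using cq by (intro tendsto_norm) (simp add: isCont_def tendsto_at_iff_tendsto_nhds)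
  have "\<forall>\<^sub>F z in nhds ?a. c < norm (B z)"
    using order_tendstoD(1)[OF nB, of c] c by (simp add: c_def)
  moreover have "\<forall>\<^sub>F z in nhds ?a. norm (q z) < C"
    using order_tendstoD(2)[OF nq, of C] C by (simp add: C_def)
  moreover have "\<forall>\<^sub>F z in nhds ?a. z \<in> ball ?a r'"
    using a by (intro eventually_nhds_in_open) auto
  ultimately have "\<forall>\<^sub>F z in nhds ?a. c < norm (B z) \<and> norm (q z) < C \<and> z \<in> ball ?a r'"
    by (intro eventually_conj)
  then obtain \<delta> where \<delta>: "\<delta> > 0" and \<delta>B: "\<And>z. dist z ?a < \<delta> \<Longrightarrow> c < norm (B z) \<and> norm (q z) < C \<and> z \<in> ball ?a r'"
    unfolding eventually_nhds_metric by blast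
  define t0 where "t0 = t1 - min \<delta> r / 2"
  have t0: "t1 - r < t0" "t1 - \<delta> < t0" "t0 < t1" using r \<delta> by (auto simp: t0_def)
  have M: "0 \<le> M"
    using bound[OF t0(1,3)] norm_ge_zero order_trans by blast
  \<comment> \<open>A bound independent of \<open>n\<close>, contradicting the exponential growth in
    \<open>n\<close>.\<close>
  define K where "K = M ^ k * C ^ p / c ^ k"
  have key: "100 ^ n / (6 * real (Suc n) ^ 2) ^ k \<le> K"
    if n: "n \<noteq> 0" "norm (\<xi> (of_real t0)) \<le> 1 - 1 / 100 ^ n" for n
  proof -
    have cont: "continuous_on {t0..t1} (\<lambda>t. norm (\<xi> (of_real t)))"
      using t0 r by (intro continuous_intros continuous_on_compose2[OF holomorphic_on_imp_continuous_on[OF hol]])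
        (auto simp: dist_of_real dist_real_def)
    have pos: "(0::real) < 1 / 100 ^ n" by simp
    \<comment> \<open>Along the segment the modulus of \<open>\<xi>\<close> must take the exact
      value for which the lower bound on the derivative is available.\<close>
    have "\<exists>t\<ge>t0. t \<le> t1 \<and> norm (\<xi> (of_real t)) = 1 - 1 / 100 ^ n"
    proof (rule IVT')
      show "1 - 1 / 100 ^ n \<le> norm (\<xi> ?a)" using outside pos by linarith
    qed (use n t0 cont in auto)
    then obtain t where t: "t0 \<le> t" "t \<le> t1" "norm (\<xi> (of_real t)) = 1 - 1 / 100 ^ n"
      by blast
    have "t \<noteq> t1"
    proof
      assume "t = t1"
      then have "1 \<le> 1 - (1::real) / 100 ^ n" using t(3) outside by metis
      then show False using pos by linarith
    qed
    then have t': "t < t1" using t by simp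
    define \<tau> where "\<tau> = t1 - t"
    define A :: real where "A = 100 ^ n"
    have A: "A > 0" by (simp add: A_def)
    have \<tau>: "\<tau> > 0" "norm (of_real t - ?a) = \<tau>"
      using t' by (auto simp: \<tau>_def simp flip: of_real_diff)
    have zb: "c < norm (B (of_real t))" "norm (q (of_real t)) < C" "of_real t \<in> ball ?a r'"
      using \<delta>B[of "of_real t"] \<tau> t t0 by (auto simp: dist_norm \<tau>_def)
    \<comment> \<open>The distance from \<open>\<xi>\<close> to its value at \<open>t1\<close> is at
      least \<open>1 / A\<close> and of order \<open>\<tau> ^ k\<close>, so \<open>\<tau>\<close>
      cannot be too small.\<close>
    have "1 / A \<le> norm (\<xi> ?a) - norm (\<xi> (of_real t))"
      using outside t(3) by (simp add: A_def)
    also have "\<dots> \<le> norm (\<xi> (of_real t) - \<xi> ?a)"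
      by (metis norm_minus_commute norm_triangle_ineq2)
    also have "\<dots> = \<tau> ^ k * norm (q (of_real t))"
      using zb by (simp add: q(2) norm_mult norm_power \<tau>)
    also have "\<dots> \<le> \<tau> ^ k * C"
      using zb \<tau> by (intro mult_left_mono) auto
    finally have tk: "1 / (A * C) \<le> \<tau> ^ k"
      using A C by (simp add: field_simps)
    have "A / (6 * real (Suc n) ^ 2) * (\<tau> ^ p * c) \<le>
        norm (deriv lacunary (\<xi> (of_real t))) * norm (deriv \<xi> (of_real t))"
    proof (rule mult_mono)
      show "A / (6 * real (Suc n) ^ 2) \<le> norm (deriv lacunary (\<xi> (of_real t)))"
        unfolding A_def using n t by (intro lacunary_deriv_lower_bound)
      show "\<tau> ^ p * c \<le> norm (deriv \<xi> (of_real t))"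
        using zb \<tau> by (simp add: d\<xi> norm_mult norm_power)
    qed (use \<tau> c A in auto)
    also have "\<dots> \<le> M"
      using bound[of t] t t' t0 by (simp add: norm_mult)
    \<comment> \<open>Raising to the power \<open>k\<close> avoids fractional exponents:
      \<open>\<tau> ^ p\<close> becomes \<open>(\<tau> ^ k) ^ p\<close>, to which the lower bound
      \<open>tk\<close> applies.\<close>
    finally have "(A / (6 * real (Suc n) ^ 2) * (\<tau> ^ p * c)) ^ k \<le> M ^ k"
      using A c \<tau> by (intro power_mono) auto
    moreover have "(A / (6 * real (Suc n) ^ 2) * (\<tau> ^ p * c)) ^ k
        = A ^ k / (6 * real (Suc n) ^ 2) ^ k * ((\<tau> ^ k) ^ p * c ^ k)"
      by (simp add: power_mult_distrib power_divide mult_ac del: of_nat_Suc flip: power_mult)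
    moreover have "A ^ k / (6 * real (Suc n) ^ 2) ^ k * ((1 / (A * C)) ^ p * c ^ k) \<le>
        A ^ k / (6 * real (Suc n) ^ 2) ^ k * ((\<tau> ^ k) ^ p * c ^ k)"
      using tk A C c by (intro mult_left_mono mult_right_mono power_mono) auto
    ultimately have "A ^ k / (6 * real (Suc n) ^ 2) ^ k * ((1 / (A * C)) ^ p * c ^ k) \<le> M ^ k"
      by linarith
    \<comment> \<open>As \<open>k = Suc p\<close>, exactly one factor \<open>A\<close> survives the
      division of \<open>A ^ k\<close> by \<open>A ^ p\<close>.\<close>
    also have "A ^ k / (6 * real (Suc n) ^ 2) ^ k * ((1 / (A * C)) ^ p * c ^ k)
        = A / (6 * real (Suc n) ^ 2) ^ k * (c ^ k / C ^ p)"
      using A C unfolding p by (simp add: power_mult_distrib power_divide del: of_nat_Suc)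
    finally show ?thesis
      using c C by (simp add: K_def A_def field_simps del: of_nat_Suc)
  qed
  have "\<forall>\<^sub>F n in sequentially. norm (\<xi> (of_real t0)) < 1 - 1 / 100 ^ n"
  proof (rule order_tendstoD(1))
    show "(\<lambda>n. 1 - 1 / 100 ^ n :: real) \<longlonglongrightarrow> 1" by real_asymp
    show "norm (\<xi> (of_real t0)) < 1" using inside t0 by simp
  qed
  moreover have "\<forall>\<^sub>F n in sequentially. K < 100 ^ n / (6 * real (Suc n) ^ 2) ^ k"
    using exponential_over_power_at_top[of k] by (simp add: filterlim_at_top_dense)
  moreover have "\<forall>\<^sub>F n in sequentially. n \<noteq> (0::nat)"
    by (rule eventually_at_top_not_equal)
  ultimately have "\<forall>\<^sub>F n :: nat in sequentially. False"
  proof eventually_elim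
    case (elim n)
    then show ?case using key[of n] by linarith
  qed
  then show False by simp
qed

section \<open>Fillings of the circle in a foliated Hartogs figure\<close>

lemma annulus_eq:
  assumes "0 < \<epsilon>" "\<epsilon> < 1"
  shows "annulus (1 - \<epsilon>) (1 + \<epsilon>) = {w. 1 - \<epsilon> < norm w \<and> norm w < 1 + \<epsilon>}"
  using assms by (auto simp: annulus_def)

text \<open>The map in question is \<open>(\<zeta> z, u z w)\<close>. Its holomorphy is recorded in
  each variable separately: for \<open>u\<^sup>2 - g \<circ> \<zeta>\<close> on the whole figure,
  and for \<open>u\<close> itself where \<open>\<zeta> z\<close> lies in \<open>U\<close>.\<close>

locale foliated_hartogs_map =
  fixes \<epsilon> :: real and \<zeta> g :: "complex \<Rightarrow> complex" and u :: "complex \<Rightarrow> complex \<Rightarrow> complex"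
    and U :: "complex set"
  assumes eps: "0 < \<epsilon>" "\<epsilon> < 1"
    and zeta: "\<zeta> holomorphic_on ball 0 (1 + \<epsilon>)"
    and U: "open U"
    and g: "continuous_on UNIV g" "g holomorphic_on U"
    and u_cont: "continuous_on (hartogs_figure \<epsilon>) (\<lambda>(z, w). u z w)"
    and sq_z: "\<And>z w. (z, w) \<in> hartogs_figure \<epsilon> \<Longrightarrow> (\<lambda>z. (u z w)\<^sup>2 - g (\<zeta> z)) field_differentiable at z"
    and sq_w: "\<And>z w. (z, w) \<in> hartogs_figure \<epsilon> \<Longrightarrow> (\<lambda>w. (u z w)\<^sup>2 - g (\<zeta> z)) field_differentiable at w"
    and u_z: "\<And>z w. (z, w) \<in> hartogs_figure \<epsilon> \<Longrightarrow> \<zeta> z \<in> U \<Longrightarrow> (\<lambda>z. u z w) field_differentiable at z"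
    and u_w: "\<And>z w. (z, w) \<in> hartogs_figure \<epsilon> \<Longrightarrow> \<zeta> z \<in> U \<Longrightarrow> u z field_differentiable at w"
    and u_nz: "\<And>z w. (z, w) \<in> hartogs_figure \<epsilon> \<Longrightarrow> \<zeta> z \<notin> U \<Longrightarrow> u z w \<noteq> 0"
    and zeta_0: "\<zeta> 0 \<in> U" and zeta_1: "\<zeta> 1 \<notin> U"
begin

abbreviation "D \<equiv> ball (0::complex) (1 + \<epsilon>)"
abbreviation "Ann \<equiv> {w::complex. 1 - \<epsilon> < norm w \<and> norm w < 1 + \<epsilon>}"
abbreviation "R \<equiv> 1 + \<epsilon> / 2"

definition "F z w = (u z w)\<^sup>2 - g (\<zeta> z)"
text \<open>The radius \<open>R\<close> lies strictly between 1 and \<open>1 + \<epsilon>\<close>: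
  the circle is inside the annulus, and the extension covers a neighbourhood of the closed unit
  disk.\<close>

definition "F\<^sub>e z = cauchy_integral R (F z)"
text \<open>The extension of \<open>u\<^sup>2\<close> into the disk: holomorphic in
  \<open>w\<close>, but in \<open>z\<close> only as regular as
  \<open>g \<circ> \<zeta>\<close>.\<close>

definition "G z w = F\<^sub>e z w + g (\<zeta> z)"
definition "u\<^sub>e z = cauchy_integral 1 (u z)"
definition "W = {z \<in> D. \<zeta> z \<in> U}"
text \<open>That is, \<open>u z\<close> continues holomorphically from the annulus to the unit disk,
  with \<open>u\<^sub>e z\<close> as the continuation.\<close>

definition "good z \<longleftrightarrow> z \<in> D \<and> (\<forall>w. 1 - \<epsilon> < norm w \<longrightarrow> norm w < 1 \<longrightarrow> u\<^sub>e z w = u z w)"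

section \<open>Regularity of the data and of their Cauchy extensions\<close>

lemma in_hartogs1: "z \<in> D \<Longrightarrow> w \<in> Ann \<Longrightarrow> (z, w) \<in> hartogs_figure \<epsilon>"
  and in_hartogs2: "norm z < \<epsilon> \<Longrightarrow> norm w < 1 + \<epsilon> \<Longrightarrow> (z, w) \<in> hartogs_figure \<epsilon>"
  using eps by (auto simp: hartogs_figure_def annulus_eq)

lemma zeta_cont: "continuous_on D \<zeta>"
  using zeta by (rule holomorphic_on_imp_continuous_on)

lemma g_zeta_cont: "continuous_on D (\<lambda>z. g (\<zeta> z))"
  by (rule continuous_on_compose2[OF g(1) zeta_cont]) auto

lemma open_W: "open W"
  using continuous_open_preimage[OF zeta_cont open_ball U] by (simp add: W_def vimage_def Int_def)

lemma u_cont': "continuous_on (D \<times> Ann) (\<lambda>(z, w). u z w)"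
  by (rule continuous_on_subset[OF u_cont]) (use in_hartogs1 in auto)

lemma F_cont: "continuous_on (D \<times> Ann) (\<lambda>(z, w). F z w)"
proof -
  have "continuous_on (D \<times> Ann) (\<lambda>p. (\<lambda>(z, w). u z w) p ^ 2 - (\<lambda>z. g (\<zeta> z)) (fst p))"
    by (intro continuous_intros u_cont' continuous_on_compose2[OF g_zeta_cont]) auto
  then show ?thesis by (simp add: F_def case_prod_unfold)
qed

lemma F_cont_circle: "continuous_on (D \<times> sphere 0 R) (\<lambda>(z, w). F z w)"
  by (rule continuous_on_subset[OF F_cont]) (use eps in auto)

lemma u_cont_circle: "continuous_on (D \<times> sphere 0 1) (\<lambda>(z, w). u z w)"
  by (rule continuous_on_subset[OF u_cont']) (use eps in auto)

lemma F_hol_z: "w \<in> Ann \<Longrightarrow> (\<lambda>z. F z w) holomorphic_on D"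
  unfolding F_def holomorphic_on_def
  using sq_z in_hartogs1 by (blast intro: field_differentiable_at_within)

lemma F_hol_w: "norm z < \<epsilon> \<Longrightarrow> F z holomorphic_on ball 0 (1 + \<epsilon>)"
  unfolding F_def holomorphic_on_def
  using sq_w in_hartogs2 by (auto intro: field_differentiable_at_within)

lemma F\<^sub>e_cont: "continuous_on (D \<times> ball 0 R) (\<lambda>(z, w). F\<^sub>e z w)"
  unfolding F\<^sub>e_def using eps by (intro continuous_on_cauchy_integral F_cont_circle) auto

lemma F\<^sub>e_hol_z: "w \<in> ball 0 R \<Longrightarrow> (\<lambda>z. F\<^sub>e z w) holomorphic_on D"
  unfolding F\<^sub>e_def using eps
  by (intro holomorphic_on_cauchy_integral_param F_cont_circle F_hol_z) auto

lemma F\<^sub>e_hol_w: "z \<in> D \<Longrightarrow> F\<^sub>e z holomorphic_on ball 0 R"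
  unfolding F\<^sub>e_def using eps
  by (intro holomorphic_on_cauchy_integral continuous_on_compose2[OF F_cont_circle, of _ "Pair z", simplified]
      continuous_intros) auto

text \<open>The Hartogs argument: for \<open>norm z < \<epsilon>\<close> the figure contains full
  disks and Cauchy's formula applies; for fixed \<open>w\<close> the identity theorem in
  \<open>z\<close> carries the equality to all of \<open>D\<close>.\<close>

lemma F\<^sub>e_eq:
  assumes z: "z \<in> D" and w: "w \<in> Ann" "norm w < R"
  shows "F\<^sub>e z w = F z w"
proof (rule analytic_continuation_open[of "ball 0 \<epsilon>" D "\<lambda>z. F\<^sub>e z w" "\<lambda>z. F z w"])
  show "F\<^sub>e y w = F y w" if "y \<in> ball 0 \<epsilon>" for y
    unfolding F\<^sub>e_def
  proof (rule cauchy_integral_eq)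
    have *: "F y holomorphic_on ball 0 (1 + \<epsilon>)" using that by (intro F_hol_w) auto
    show "continuous_on (cball 0 R) (F y)"
      by (rule continuous_on_subset[OF holomorphic_on_imp_continuous_on[OF *]]) (use eps in auto)
    show "F y holomorphic_on ball 0 R"
      by (rule holomorphic_on_subset[OF *]) (use eps in auto)
  qed (use w in auto)
qed (use eps z w F_hol_z F\<^sub>e_hol_z in auto)

lemma G_cont: "continuous_on (D \<times> ball 0 R) (\<lambda>(z, w). G z w)"
proof -
  have "continuous_on (D \<times> ball 0 R) (\<lambda>p. (\<lambda>(z, w). F\<^sub>e z w) p + (\<lambda>z. g (\<zeta> z)) (fst p))"
    by (intro continuous_intros F\<^sub>e_cont continuous_on_compose2[OF g_zeta_cont]) auto
  then show ?thesis by (simp add: G_def case_prod_unfold)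
qed

lemma G_hol_w: "z \<in> D \<Longrightarrow> G z holomorphic_on ball 0 R"
  unfolding G_def by (intro holomorphic_intros F\<^sub>e_hol_w)

lemma G_eq: "z \<in> D \<Longrightarrow> w \<in> Ann \<Longrightarrow> norm w < R \<Longrightarrow> G z w = (u z w)\<^sup>2"
  by (simp add: G_def F\<^sub>e_eq F_def)

lemma u_hol_z: "w \<in> Ann \<Longrightarrow> (\<lambda>z. u z w) holomorphic_on W"
  unfolding holomorphic_on_def W_def
  using u_z in_hartogs1 by (blast intro: field_differentiable_at_within)

lemma u\<^sub>e_hol_z: "w \<in> ball 0 1 \<Longrightarrow> (\<lambda>z. u\<^sub>e z w) holomorphic_on W"
  unfolding u\<^sub>e_def using eps
  by (intro holomorphic_on_cauchy_integral_param u_hol_z open_W continuous_on_subset[OF u_cont_circle])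
    (auto simp: W_def)

lemma u\<^sub>e_hol_w: "z \<in> D \<Longrightarrow> u\<^sub>e z holomorphic_on ball 0 1"
  unfolding u\<^sub>e_def using eps
  by (intro holomorphic_on_cauchy_integral continuous_on_compose2[OF u_cont_circle, of _ "Pair z", simplified]
      continuous_intros) auto

text \<open>Near 0 the figure contains the full vertical disks and \<open>\<zeta>\<close> takes
  values in \<open>U\<close>, so \<open>u z\<close> is itself holomorphic there and Cauchy's formula
  reproduces it.\<close>

lemma good_near_0: "\<exists>\<delta>>0. \<forall>z\<in>ball 0 \<delta>. good z"
proof -
  have "0 \<in> W \<inter> ball 0 \<epsilon>" using eps zeta_0 by (auto simp: W_def)
  then obtain \<delta> where \<delta>: "\<delta> > 0" "ball 0 \<delta> \<subseteq> W \<inter> ball 0 \<epsilon>"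
    by (meson open_Int open_W open_ball open_contains_ball)
  have "good z" if z: "z \<in> ball 0 \<delta>" for z
  proof -
    have zW: "z \<in> W" "norm z < \<epsilon>" using \<delta> z by auto
    then have hol: "u z holomorphic_on ball 0 (1 + \<epsilon>)"
      unfolding holomorphic_on_def W_def using u_w in_hartogs2
      by (auto intro: field_differentiable_at_within)
    have "u\<^sub>e z w = u z w" if "norm w < 1" for w
      unfolding u\<^sub>e_def
    proof (rule cauchy_integral_eq)
      show "continuous_on (cball 0 1) (u z)"
        by (rule continuous_on_subset[OF holomorphic_on_imp_continuous_on[OF hol]]) (use eps in auto)
      show "u z holomorphic_on ball 0 1"
        by (rule holomorphic_on_subset[OF hol]) (use eps in auto)
    qed (use that in auto)
    then show ?thesis using zW by (auto simp: good_def W_def)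
  qed
  then show ?thesis using \<delta> by blast
qed

text \<open>The identity theorem in \<open>z\<close> for fixed \<open>w\<close> in the annulus; both
  \<open>u\<close> and \<open>u\<^sub>e\<close> are holomorphic in \<open>z\<close> over
  \<open>W\<close>.\<close>

lemma good_propagate:
  assumes S: "open S" "connected S" "S \<subseteq> W" and T: "open T" "T \<noteq> {}" "T \<subseteq> S" "\<And>z. z \<in> T \<Longrightarrow> good z"
    and z: "z \<in> S"
  shows "good z"
proof -
  have "u\<^sub>e z w = u z w" if w: "1 - \<epsilon> < norm w" "norm w < 1" for w
  proof (rule analytic_continuation_open[of T S "\<lambda>z. u\<^sub>e z w" "\<lambda>z. u z w"])
    show "(\<lambda>z. u\<^sub>e z w) holomorphic_on S" "(\<lambda>z. u z w) holomorphic_on S"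
      using S w eps by (auto intro!: holomorphic_on_subset[OF u\<^sub>e_hol_z] holomorphic_on_subset[OF u_hol_z])
    show "u\<^sub>e y w = u y w" if "y \<in> T" for y
      using T(4)[OF that] w by (auto simp: good_def)
  qed (use S T z in auto)
  then show ?thesis using z S by (auto simp: good_def W_def)
qed

text \<open>A zero-free \<open>G z\<close> has a holomorphic square root \<open>v\<close> on a
  slightly larger disk. On the annulus \<open>u z\<close> and \<open>v\<close> have equal squares,
  so their ratio is a constant sign by connectedness. The argument concerns a single
  \<open>z\<close> and covers \<open>\<zeta> z\<close> outside \<open>U\<close> too.\<close>

lemma zero_free_extension:
  assumes z: "z \<in> D" and nz: "\<And>w. w \<in> cball 0 1 \<Longrightarrow> G z w \<noteq> 0"
  shows "\<exists>v. continuous_on (cball 0 1) v \<and> v holomorphic_on ball 0 1 \<and> (\<forall>w\<in>cball 0 1. v w \<noteq> 0) \<and>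
    (\<forall>w. 1 - \<epsilon> < norm w \<longrightarrow> norm w \<le> 1 \<longrightarrow> v w = u z w)"
proof -
  have Gc: "continuous_on (ball 0 R) (G z)"
    using G_hol_w[OF z] by (rule holomorphic_on_imp_continuous_on)
  have "open {w \<in> ball 0 R. G z w \<noteq> 0}"
    using continuous_open_preimage[OF Gc open_ball, of "- {0}"] by (simp add: vimage_def Int_def open_Compl)
  moreover have "cball 0 1 \<subseteq> {w \<in> ball 0 R. G z w \<noteq> 0}"
    using nz eps by auto
  ultimately obtain e where e: "0 < e" "(\<Union>x\<in>cball 0 1. cball x e) \<subseteq> {w \<in> ball 0 R. G z w \<noteq> 0}"
    by (rule compact_subset_open_imp_cball_epsilon_subset[OF compact_cball])
  have sub: "ball 0 (1 + e) \<subseteq> {w \<in> ball 0 R. G z w \<noteq> 0}"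
  proof
    fix w :: complex assume w: "w \<in> ball 0 (1 + e)"
    \<comment> \<open>The point of the closed unit disk nearest to \<open>w\<close>.\<close>
    define x where "x = (if norm w \<le> 1 then w else w /\<^sub>R norm w)"
    have "x \<in> cball 0 1" by (cases "w = 0") (auto simp: x_def)
    moreover have "dist x w \<le> e"
    proof (cases "norm w \<le> 1")
      case False
      then have "dist x w = norm ((1 / norm w - 1) *\<^sub>R w)"
        by (simp add: x_def dist_norm scaleR_diff_left divide_inverse)
      also have "\<dots> = \<bar>1 / norm w - 1\<bar> * norm w" by simp
      also have "\<dots> = norm w - 1"
      proof -
        have "1 < norm w" "w \<noteq> 0" using False by auto
        then show ?thesis by (subst abs_of_nonpos) (auto simp: field_simps)
      qed
      finally show ?thesis using w by simp
    qed (use e in \<open>simp add: x_def\<close>)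
    ultimately have "w \<in> (\<Union>x\<in>cball 0 1. cball x e)" by (intro UN_I[of x]) auto
    then show "w \<in> {w \<in> ball 0 R. G z w \<noteq> 0}" using e(2) by blast
  qed
  have "G z holomorphic_on ball 0 (1 + e)"
    using sub by (intro holomorphic_on_subset[OF G_hol_w[OF z]]) auto
  moreover have "contractible (ball (0::complex) (1 + e))"
    by (intro convex_imp_contractible convex_ball)
  moreover have "G z w \<noteq> 0" if "w \<in> ball 0 (1 + e)" for w
    using sub that by auto
  ultimately have "\<exists>v. v holomorphic_on ball 0 (1 + e) \<and> (\<forall>w\<in>ball 0 (1 + e). G z w = (v w)\<^sup>2)"
    by (metis contractible_imp_holomorphic_sqrt)
  then obtain v where v: "v holomorphic_on ball 0 (1 + e)" "\<And>w. w \<in> ball 0 (1 + e) \<Longrightarrow> G z w = (v w)\<^sup>2"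
    by blast
  define A where "A = {w::complex. 1 - \<epsilon> < norm w \<and> norm w \<le> 1}"
  have A: "A \<subseteq> Ann" "A \<subseteq> ball 0 R" "A \<subseteq> ball 0 (1 + e)" "A \<subseteq> cball 0 1"
    using eps e by (auto simp: A_def)
  have vnz: "v w \<noteq> 0" if "w \<in> cball 0 1" for w
    using nz[OF that] v(2)[of w] that e by auto
  have vc: "continuous_on (ball 0 (1 + e)) v"
    using v(1) by (rule holomorphic_on_imp_continuous_on)
  have conA: "connected A"
    using connected_annulus(2)[where a = "0::complex"] by (simp add: A_def)
  have uc: "continuous_on A (u z)"
    using A z by (intro continuous_on_compose2[OF u_cont', of A "Pair z", simplified] continuous_intros) auto
  \<comment> \<open>A continuous function with values in \<open>{1, -1}\<close> on a connected
    set.\<close>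
  have "(\<lambda>w. u z w / v w) constant_on A"
  proof (rule continuous_finite_range_constant)
    show "connected A" by fact
    show "continuous_on A (\<lambda>w. u z w / v w)"
      using A vnz by (intro continuous_intros uc continuous_on_subset[OF vc]) auto
    have "u z w / v w \<in> {1, -1}" if "w \<in> A" for w
    proof -
      have "(u z w)\<^sup>2 = (v w)\<^sup>2"
        using G_eq[OF z, of w] v(2)[of w] that eps e by (auto simp: A_def)
      then have "u z w = v w \<or> u z w = - v w" by (simp only: power2_eq_iff)
      moreover have "v w \<noteq> 0" using that by (intro vnz) (simp add: A_def)
      ultimately show ?thesis by auto
    qed
    then have "(\<lambda>w. u z w / v w) ` A \<subseteq> {1, -1}" by blast
    then show "finite ((\<lambda>w. u z w / v w) ` A)"
      by (rule finite_subset) simp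
  qed
  then obtain k where k: "\<And>w. w \<in> A \<Longrightarrow> u z w / v w = k" unfolding constant_on_def by blast
  have k1: "u z w = k * v w" if "w \<in> A" for w
    using k[OF that] vnz[of w] that by (auto simp: A_def field_simps)
  have k0: "k \<noteq> 0"
  proof -
    have 1: "1 \<in> A" using eps by (simp add: A_def)
    have "G z 1 = (u z 1)\<^sup>2" using eps by (intro G_eq z) auto
    moreover have "G z 1 \<noteq> 0" by (intro nz) simp
    ultimately show ?thesis using k1[OF 1] by auto
  qed
  show ?thesis
  proof (intro exI[of _ "\<lambda>w. k * v w"] conjI ballI allI impI)
    show "continuous_on (cball 0 1) (\<lambda>w. k * v w)"
      using e by (intro continuous_intros continuous_on_subset[OF vc]) auto
    show "(\<lambda>w. k * v w) holomorphic_on ball 0 1"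
      using e by (intro holomorphic_intros holomorphic_on_subset[OF v(1)]) auto
  qed (use k0 vnz k1 in \<open>auto simp: A_def\<close>)
qed

text \<open>The Cauchy integral \<open>u\<^sub>e z\<close> sees only the unit circle, where
  \<open>u z\<close> coincides with its extension \<open>v\<close>; it therefore reproduces
  \<open>v\<close>.\<close>

lemma good_zero_free:
  assumes z: "z \<in> D" and nz: "\<And>w. w \<in> cball 0 1 \<Longrightarrow> G z w \<noteq> 0"
  shows "good z"
proof -
  obtain v where v: "continuous_on (cball 0 1) v" "v holomorphic_on ball 0 1"
      "\<And>w. 1 - \<epsilon> < norm w \<Longrightarrow> norm w \<le> 1 \<Longrightarrow> v w = u z w"
    using zero_free_extension[OF assms] by blast
  have "u\<^sub>e z w = u z w" if "1 - \<epsilon> < norm w" "norm w < 1" for w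
  proof -
    have "u\<^sub>e z w = cauchy_integral 1 v w"
      unfolding u\<^sub>e_def cauchy_integral_def using v(3) eps
      by (intro arg_cong2[where f = "(/)"] contour_integral_cong) auto
    also have "\<dots> = v w" using v that by (intro cauchy_integral_eq) auto
    finally show ?thesis using v(3) that by simp
  qed
  then show ?thesis using z by (simp add: good_def)
qed

text \<open>Both sides are holomorphic in \<open>w\<close> on the disk and agree on the annulus,
  where both equal the square of \<open>u\<close>.\<close>

lemma good_square:
  assumes "good z" and w: "w \<in> ball 0 1"
  shows "(u\<^sub>e z w)\<^sup>2 = G z w"
proof -
  define A where "A = {w::complex. 1 - \<epsilon> < norm w \<and> norm w < 1}"
  have z: "z \<in> D" using assms by (simp add: good_def)
  have oA: "open A"
  proof -
    have "A = ball 0 1 - cball 0 (1 - \<epsilon>)" by (auto simp: A_def)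
    then show ?thesis by (simp add: open_Diff)
  qed
  have "of_real (1 - \<epsilon> / 2) \<in> A" using eps by (simp add: A_def del: of_real_diff)
  then have neA: "A \<noteq> {}" by blast
  show ?thesis
  proof (rule analytic_continuation_open[of A "ball 0 1" "\<lambda>w. (u\<^sub>e z w)\<^sup>2" "G z"])
    show "(u\<^sub>e z w)\<^sup>2 = G z w" if "w \<in> A" for w
      using assms that eps z by (auto simp: good_def A_def G_eq)
    show "(\<lambda>w. (u\<^sub>e z w)\<^sup>2) holomorphic_on ball 0 1"
      by (intro holomorphic_intros u\<^sub>e_hol_w z)
    show "G z holomorphic_on ball 0 1"
      by (rule holomorphic_on_subset[OF G_hol_w[OF z]]) (use eps in auto)
  qed (use w oA neA in \<open>auto simp: A_def\<close>)
qed

text \<open>At a zero of the extended \<open>u\<close> its square has vanishing derivative in every direction.\<close>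

lemma deriv_at_zero:
  assumes T: "open T" "T \<subseteq> W" "\<And>z. z \<in> T \<Longrightarrow> good z" and z: "z \<in> T"
    and w: "w \<in> ball 0 1" and G0: "G z w = 0"
  shows "deriv g (\<zeta> z) * deriv \<zeta> z = - deriv (\<lambda>z. F\<^sub>e z w) z"
proof -
  have zW: "z \<in> W" "z \<in> D" "\<zeta> z \<in> U" using T z by (auto simp: W_def)
  have u0: "u\<^sub>e z w = 0" using good_square[OF T(3)[OF z] w] G0 by simp
  have du: "((\<lambda>z. u\<^sub>e z w) has_field_derivative deriv (\<lambda>z. u\<^sub>e z w) z) (at z)"
    using u\<^sub>e_hol_z[OF w] zW open_W by (intro holomorphic_derivI)
  have dF: "((\<lambda>z. F\<^sub>e z w) has_field_derivative deriv (\<lambda>z. F\<^sub>e z w) z) (at z)"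
    using w eps zW by (intro holomorphic_derivI[OF F\<^sub>e_hol_z open_ball]) auto
  have d\<zeta>: "(\<zeta> has_field_derivative deriv \<zeta> z) (at z)"
    using zeta zW by (intro holomorphic_derivI[of \<zeta> D]) auto
  have dg: "(g has_field_derivative deriv g (\<zeta> z)) (at (\<zeta> z))"
    using g(2) U zW by (intro holomorphic_derivI[of g U]) auto
  have 1: "((\<lambda>z. (u\<^sub>e z w)\<^sup>2) has_field_derivative 0) (at z)"
    using DERIV_mult[OF du du] u0 by (simp add: power2_eq_square)
  have 2: "((\<lambda>z. F\<^sub>e z w + g (\<zeta> z)) has_field_derivative
      deriv (\<lambda>z. F\<^sub>e z w) z + deriv g (\<zeta> z) * deriv \<zeta> z) (at z)"
    by (intro DERIV_add dF DERIV_chain2[OF dg d\<zeta>])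
  have "((\<lambda>z. F\<^sub>e z w + g (\<zeta> z)) has_field_derivative 0) (at z)"
    by (rule has_field_derivative_transform_within_open[OF 1 T(1) z])
      (use good_square[OF T(3) w] in \<open>simp add: G_def\<close>)
  from DERIV_unique[OF this 2] show ?thesis
    by (metis add.commute add_eq_0_iff)
qed

section \<open>Persistence of zeros and of their absence\<close>

lemma compact_zeros:
  assumes "compact K" "K \<subseteq> D"
  shows "compact {(z, w). z \<in> K \<and> w \<in> cball 0 1 \<and> G z w = 0}"
proof -
  have "continuous_on (K \<times> cball 0 1) (\<lambda>(z, w). G z w)"
    by (rule continuous_on_subset[OF G_cont]) (use assms eps in auto)
  moreover have "closed (K \<times> cball (0::complex) 1)"
    using assms by (simp add: closed_Times compact_imp_closed)
  ultimately have "closed ((K \<times> cball 0 1) \<inter> (\<lambda>(z, w). G z w) -` {0})"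
    by (intro continuous_closed_preimage) auto
  then have "compact ((K \<times> cball 0 1) \<inter> ((K \<times> cball 0 1) \<inter> (\<lambda>(z, w). G z w) -` {0}))"
    using assms by (intro compact_Int_closed compact_Times) auto
  moreover have "(K \<times> cball 0 1) \<inter> ((K \<times> cball 0 1) \<inter> (\<lambda>(z, w). G z w) -` {0}) =
      {(z, w). z \<in> K \<and> w \<in> cball 0 1 \<and> G z w = 0}" by auto
  ultimately show ?thesis by simp
qed

text \<open>The parameters near \<open>z\<close> whose disk contains a zero form the projection of a
  compact set, hence a closed set, and \<open>z\<close> is not among them.\<close>

lemma good_near_zero_free:
  assumes z: "z \<in> D" and nz: "\<And>w. w \<in> cball 0 1 \<Longrightarrow> G z w \<noteq> 0"
  shows "\<exists>\<delta>>0. \<forall>y\<in>ball z \<delta>. good y"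
proof -
  obtain r where r: "r > 0" "cball z r \<subseteq> D"
    using z open_contains_cball[of D] open_ball by blast
  let ?K = "{(y, w). y \<in> cball z r \<and> w \<in> cball 0 1 \<and> G y w = 0}"
  have "closed (fst ` ?K)"
    by (intro compact_imp_closed compact_continuous_image compact_zeros r continuous_intros) auto
  then have "open (- (fst ` ?K) \<inter> ball z r)" by (intro open_Int open_Compl) auto
  moreover have "z \<in> - (fst ` ?K) \<inter> ball z r" using nz r by auto
  ultimately obtain \<delta> where \<delta>: "\<delta> > 0" "ball z \<delta> \<subseteq> - (fst ` ?K) \<inter> ball z r"
    by (rule openE)
  have "good y" if y: "y \<in> ball z \<delta>" for y
  proof (rule good_zero_free)
    have "y \<in> cball z r" "y \<notin> fst ` ?K" using y \<delta> by auto
    then show "G y w \<noteq> 0" if "w \<in> cball 0 1" for w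
      using r that by (auto simp: image_iff)
    from \<open>y \<in> cball z r\<close> r show "y \<in> D" by auto
  qed
  then show ?thesis using \<delta> by blast
qed

text \<open>Hurwitz: the minimum modulus of a zero-free function on the disc is attained on the circle.\<close>

lemma zeros_nearby:
  assumes z: "z \<in> D" and zU: "\<zeta> z \<notin> U" and w0: "w0 \<in> cball 0 1" "G z w0 = 0"
  shows "\<exists>r>0. ball z r \<subseteq> D \<and> (\<forall>y\<in>ball z r. \<exists>w\<in>ball 0 1. G y w = 0)"
proof -
  obtain r0 where r0: "r0 > 0" "cball z r0 \<subseteq> D"
    using z open_contains_cball[of D] open_ball by blast
  have G: "continuous_on (cball z r0 \<times> cball 0 1) (\<lambda>(z, w). G z w)"
    by (rule continuous_on_subset[OF G_cont]) (use r0 eps in auto)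
  have Gy: "continuous_on (cball 0 1) (G y)" if "y \<in> D" for y
    by (rule continuous_on_subset[OF holomorphic_on_imp_continuous_on[OF G_hol_w[OF that]]]) (use eps in auto)
  have "continuous_on (sphere 0 1) (\<lambda>w. norm (G z w))"
    by (intro continuous_intros continuous_on_subset[OF Gy[OF z]]) auto
  then obtain w1 where w1: "w1 \<in> sphere 0 1" "\<And>w. w \<in> sphere 0 1 \<Longrightarrow> norm (G z w1) \<le> norm (G z w)"
    using continuous_attains_inf[of "sphere (0::complex) 1" "\<lambda>w. norm (G z w)"] by auto
  define d where "d = norm (G z w1)"
  \<comment> \<open>On the unit circle \<open>G z\<close> is the square of \<open>u z\<close>, which
    is nonzero because \<open>\<zeta> z\<close> lies outside \<open>U\<close>.\<close>
  have d: "d > 0"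
  proof -
    have w1A: "w1 \<in> Ann" "norm w1 < R" using w1 eps by auto
    then have "G z w1 \<noteq> 0"
      using u_nz[OF in_hartogs1[OF z w1A(1)] zU] by (simp add: G_eq[OF z])
    then show ?thesis by (simp add: d_def)
  qed
  have "uniformly_continuous_on (cball z r0 \<times> cball 0 1) (\<lambda>(z, w). G z w)"
    using G by (intro compact_uniformly_continuous compact_Times) auto
  then obtain \<delta> where \<delta>: "\<delta> > 0" "\<And>p q. p \<in> cball z r0 \<times> cball 0 1 \<Longrightarrow> q \<in> cball z r0 \<times> cball 0 1 \<Longrightarrow>
      dist q p < \<delta> \<Longrightarrow> dist ((\<lambda>(z, w). G z w) q) ((\<lambda>(z, w). G z w) p) < d / 3"
    unfolding uniformly_continuous_on_def using d by (metis zero_less_divide_iff zero_less_numeral)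
  have close: "norm (G y w - G z w) < d / 3" if "y \<in> ball z (min r0 \<delta>)" "w \<in> cball 0 1" for y w
    using \<delta>(2)[of "(z, w)" "(y, w)"] that r0 by (auto simp: dist_norm dist_Pair_Pair norm_minus_commute)
  have "\<exists>w\<in>ball 0 1. G y w = 0" if y: "y \<in> ball z (min r0 \<delta>)" for y
  proof (rule ccontr)
    assume neg: "\<not> ?thesis"
    have "y \<in> cball z r0" using y by auto
    then have yD: "y \<in> D" using r0 by blast
    have sph: "2 * d / 3 \<le> norm (G y w)" if "w \<in> sphere 0 1" for w
    proof -
      have "norm (G z w) \<le> norm (G y w) + norm (G z w - G y w)" by (rule norm_triangle_sub)
      moreover have "norm (G y w - G z w) < d / 3" using that by (intro close y) auto
      moreover have "d \<le> norm (G z w)" using w1(2)[OF that] by (simp add: d_def)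
      ultimately show ?thesis by (simp add: norm_minus_commute)
    qed
    have nz: "G y w \<noteq> 0" if "w \<in> cball 0 1" for w
    proof (cases "norm w = 1")
      case True
      then show ?thesis using sph[of w] d by auto
    next
      case False
      then show ?thesis using neg that by auto
    qed
    \<comment> \<open>On the circle \<open>norm (G y w)\<close> is at least
      \<open>2 * d / 3\<close>, while at \<open>w0\<close> it is below \<open>d / 3\<close>; the
      maximum principle for \<open>1 / G y\<close> excludes this.\<close>
    have "norm (inverse (G y w0)) \<le> 3 / (2 * d)"
    proof (rule maximum_modulus_frontier[of "\<lambda>w. inverse (G y w)" "ball 0 1"])
      show "(\<lambda>w. inverse (G y w)) holomorphic_on interior (ball 0 1)"
        using nz eps by (auto intro!: holomorphic_intros holomorphic_on_subset[OF G_hol_w[OF yD]])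
      show "continuous_on (closure (ball 0 1)) (\<lambda>w. inverse (G y w))"
        using nz Gy[OF yD] by (auto intro!: continuous_intros)
      show "norm (inverse (G y w)) \<le> 3 / (2 * d)" if "w \<in> frontier (ball 0 1)" for w
      proof -
        have "2 * d / 3 \<le> norm (G y w)" using that by (intro sph) auto
        then have "inverse (norm (G y w)) \<le> inverse (2 * d / 3)" using d by (intro le_imp_inverse_le) auto
        then show ?thesis by (simp add: norm_inverse)
      qed
      show "w0 \<in> ball 0 1"
        using w0 w1(2)[of w0] d by (cases "norm w0 = 1") (auto simp: d_def)
    qed auto
    moreover have "norm (G y w0) < d / 3"
      using close[OF y w0(1)] w0(2) by simp
    moreover have "0 < norm (G y w0)" using nz[OF w0(1)] by simp
    ultimately show False
      unfolding norm_inverse using d by (simp add: field_simps)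
  qed
  then show ?thesis using r0 \<delta> by (intro exI[of _ "min r0 \<delta>"]) auto
qed

text \<open>The bound is uniform in \<open>w\<close> because the zero at which it will be evaluated
  moves with \<open>y\<close>.\<close>

lemma F\<^sub>e_deriv_bounded:
  assumes z: "z \<in> D"
  shows "\<exists>r>0. \<exists>M. \<forall>y\<in>ball z r. \<forall>w\<in>cball 0 1. norm (deriv (\<lambda>z. F\<^sub>e z w) y) \<le> M"
proof -
  obtain r where r: "r > 0" "cball z r \<subseteq> D"
    using z open_contains_cball[of D] open_ball by blast
  have "continuous_on (ball z r \<times> cball 0 1) (\<lambda>(y, w). deriv (\<lambda>z. F\<^sub>e z w) y)"
    using r eps by (intro continuous_on_deriv_param continuous_on_subset[OF F\<^sub>e_cont]
        holomorphic_on_subset[OF F\<^sub>e_hol_z]) auto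
  then have "continuous_on (cball z (r / 2) \<times> cball 0 1) (\<lambda>(y, w). deriv (\<lambda>z. F\<^sub>e z w) y)"
    by (rule continuous_on_subset) (use r in auto)
  then have "compact ((\<lambda>(y, w). deriv (\<lambda>z. F\<^sub>e z w) y) ` (cball z (r / 2) \<times> cball 0 1))"
    by (intro compact_continuous_image compact_Times) auto
  then have "bounded ((\<lambda>(y, w). deriv (\<lambda>z. F\<^sub>e z w) y) ` (cball z (r / 2) \<times> cball 0 1))"
    by (rule compact_imp_bounded)
  then obtain M where "\<And>y w. y \<in> cball z (r / 2) \<Longrightarrow> w \<in> cball 0 1 \<Longrightarrow> norm (deriv (\<lambda>z. F\<^sub>e z w) y) \<le> M"
    unfolding bounded_iff by fastforce
  then show ?thesis using r by (intro exI[of _ "r / 2"] conjI exI[of _ M]) auto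
qed

text \<open>Connectedness of the half-open segment: each of its points lies in the interior of the
  good set or off the closure of that interior. Where \<open>\<zeta>\<close> is in \<open>U\<close>
  this is propagation on a small disk; elsewhere the absence of zeros makes a neighbourhood
  good.\<close>

lemma good_segment:
  assumes t1: "0 < t1" "t1 \<le> 1"
    and nz: "\<And>t w. 0 \<le> t \<Longrightarrow> t < t1 \<Longrightarrow> \<zeta> (of_real t) \<notin> U \<Longrightarrow> w \<in> cball 0 1 \<Longrightarrow> G (of_real t) w \<noteq> 0"
    and t: "0 \<le> t" "t < t1"
  shows "of_real t \<in> interior {z. good z}"
proof -
  define Gd where "Gd = interior {z. good z}"
  let ?S = "of_real ` {0..<t1} :: complex set"
  have SD: "?S \<subseteq> D" using t1 eps by auto
  have loc: "s \<in> Gd \<union> - closure Gd" if s: "s \<in> ?S" for s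
  proof (cases "\<zeta> s \<in> U")
    case True
    then have "s \<in> W" using s SD by (auto simp: W_def)
    then obtain e where e: "e > 0" "ball s e \<subseteq> W" using open_W open_contains_ball by blast
    show ?thesis
    proof (cases "ball s e \<inter> Gd = {}")
      case True
      then have "ball s e \<inter> closure Gd = {}"
        by (simp add: open_Int_closure_eq_empty)
      then show ?thesis using e centre_in_ball by blast
    next
      case False
      have "good y" if "y \<in> ball s e" for y
        by (rule good_propagate[OF open_ball connected_ball e(2) _ False _ _ that])
          (use interior_subset in \<open>auto simp: Gd_def\<close>)
      then have "s \<in> Gd" unfolding Gd_def
        using e by (intro interiorI[of "ball s e"]) auto
      then show ?thesis by simp
    qed
  next
    case False
    have "G s w \<noteq> 0" if "w \<in> cball 0 1" for w
      using nz[OF _ _ _ that] s False by auto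
    then obtain r where "r > 0" "\<forall>y\<in>ball s r. good y"
      using good_near_zero_free[of s] s SD by blast
    then have "s \<in> Gd" unfolding Gd_def by (intro interiorI[of "ball s r"]) auto
    then show ?thesis by simp
  qed
  have "connected ?S"
    by (intro connected_continuous_image continuous_intros) auto
  moreover have "0 \<in> Gd \<inter> ?S"
  proof -
    obtain r where "r > 0" "\<forall>y\<in>ball 0 r. good y" using good_near_0 by blast
    then have "0 \<in> Gd" unfolding Gd_def by (intro interiorI[of "ball 0 r"]) auto
    then show ?thesis using t1 by (auto intro!: image_eqI[of _ _ 0])
  qed
  moreover have "Gd \<inter> - closure Gd \<inter> ?S = {}"
    using closure_subset by auto
  ultimately have "- closure Gd \<inter> ?S = {}"
    using connectedD[of ?S Gd "- closure Gd"] loc by (auto simp: Gd_def)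
  then show ?thesis using loc[of "of_real t"] t by (auto simp: Gd_def)
qed

text \<open>Take the first \<open>t1\<close> with \<open>\<zeta>\<close> outside \<open>U\<close>
  and a zero of \<open>G\<close>. Zeros persist just before \<open>t1\<close>, so by minimality
  \<open>\<zeta>\<close> is in \<open>U\<close> there; these parameters are good by
  \<open>good_segment\<close>, and \<open>deriv_at_zero\<close> turns the bound on the derivative of
  \<open>F\<^sub>e\<close> into the claimed one.\<close>

theorem zero_free_or_bounded_deriv:
  "(\<exists>t1 r M. 0 < r \<and> 0 < t1 \<and> t1 \<le> 1 \<and> \<zeta> (of_real t1) \<notin> U \<and>
     (\<forall>t. t1 - r < t \<longrightarrow> t < t1 \<longrightarrow>
       \<zeta> (of_real t) \<in> U \<and> norm (deriv g (\<zeta> (of_real t)) * deriv \<zeta> (of_real t)) \<le> M)) \<or>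
   (\<forall>w\<in>cball 0 1. G 1 w \<noteq> 0)"
proof (rule disjCI)
  assume "\<not> (\<forall>w\<in>cball 0 1. G 1 w \<noteq> 0)"
  define I where "I = {t. 0 \<le> t \<and> t \<le> 1 \<and> \<zeta> (of_real t) \<notin> U \<and> (\<exists>w\<in>cball 0 1. G (of_real t) w = 0)}"
  have I1: "1 \<in> I"
    using \<open>\<not> (\<forall>w\<in>cball 0 1. G 1 w \<noteq> 0)\<close> zeta_1 by (auto simp: I_def)
  \<comment> \<open>Removing the open set \<open>W\<close> from the segment leaves a compact set, so
    \<open>I\<close> is a projection of a compact zero set and has a least element.\<close>
  let ?K = "{(z, w). z \<in> of_real ` {0..1} - W \<and> w \<in> cball 0 1 \<and> G z w = 0}"
  have KD: "of_real ` {0..1::real} \<subseteq> D" using eps by auto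
  have "compact (of_real ` {0..1} - W)"
    using open_W by (intro compact_diff compact_continuous_image continuous_intros) auto
  then have "compact ?K" using KD by (intro compact_zeros) auto
  then have "compact (Re ` fst ` ?K)"
    by (intro compact_continuous_image continuous_intros)
  moreover have "Re ` fst ` ?K = I"
  proof -
    have "t \<in> Re ` fst ` ?K" if "t \<in> I" for t
    proof -
      from that obtain w where "w \<in> cball 0 1" "G (of_real t) w = 0" by (auto simp: I_def)
      then have "(of_real t, w) \<in> ?K" using that by (auto simp: I_def W_def)
      then show ?thesis by force
    qed
    moreover have "Re ` fst ` ?K \<subseteq> I" using KD by (auto simp: I_def W_def)
    ultimately show ?thesis by blast
  qed
  ultimately have "compact I" by simp
  then obtain t1 where t1: "t1 \<in> I" "\<And>t. t \<in> I \<Longrightarrow> t1 \<le> t"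
    using compact_attains_inf[of I] I1 by blast
  have t1b: "0 < t1" "t1 \<le> 1" "\<zeta> (of_real t1) \<notin> U"
    using t1(1) zeta_0 by (auto simp: I_def intro: ccontr)
  have t1D: "of_real t1 \<in> D" using t1b eps by auto
  obtain w0 where w0: "w0 \<in> cball 0 1" "G (of_real t1) w0 = 0" using t1(1) by (auto simp: I_def)
  obtain r1 where r1: "r1 > 0" "ball (of_real t1) r1 \<subseteq> D"
      "\<And>y. y \<in> ball (of_real t1) r1 \<Longrightarrow> \<exists>w\<in>ball 0 1. G y w = 0"
    using zeros_nearby[OF t1D t1b(3) w0] by blast
  obtain r2 M where r2: "r2 > 0"
      "\<And>y w. y \<in> ball (of_real t1) r2 \<Longrightarrow> w \<in> cball 0 1 \<Longrightarrow> norm (deriv (\<lambda>z. F\<^sub>e z w) y) \<le> M"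
    using F\<^sub>e_deriv_bounded[OF t1D] by blast
  \<comment> \<open>The bound by \<open>t1\<close> keeps the parameters considered nonnegative, as
    required for the comparison with \<open>I\<close>.\<close>
  define r where "r = min (min r1 r2) t1"
  have "\<zeta> (of_real t) \<in> U \<and> norm (deriv g (\<zeta> (of_real t)) * deriv \<zeta> (of_real t)) \<le> M"
    if t: "t1 - r < t" "t < t1" for t
  proof
    have tr: "0 \<le> t" "of_real t \<in> ball (complex_of_real t1) r1" "of_real t \<in> ball (complex_of_real t1) r2"
      using t by (auto simp: r_def dist_of_real dist_real_def)
    obtain w where w: "w \<in> ball 0 1" "G (of_real t) w = 0" using r1(3)[OF tr(2)] by blast
    show tU: "\<zeta> (of_real t) \<in> U"
    proof (rule ccontr)
      assume "\<zeta> (of_real t) \<notin> U"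
      then have "t \<in> I" using w tr t t1b by (force simp: I_def)
      then show False using t1(2) t by force
    qed
    have nz: "G (of_real s) w \<noteq> 0"
      if "0 \<le> s" "s < t1" "\<zeta> (of_real s) \<notin> U" "w \<in> cball 0 1" for s w
    proof
      assume "G (of_real s) w = 0"
      then have "s \<in> I" using that t1b by (auto simp: I_def)
      then show False using t1(2) that by force
    qed
    have "deriv g (\<zeta> (of_real t)) * deriv \<zeta> (of_real t) = - deriv (\<lambda>z. F\<^sub>e z w) (of_real t)"
    proof (rule deriv_at_zero[of "W \<inter> interior {z. good z}"])
      show "of_real t \<in> W \<inter> interior {z. good z}"
        using good_segment[OF t1b(1,2) nz tr(1) t(2)] tU subsetD[OF r1(2) tr(2)] by (auto simp: W_def)
    qed (use w interior_subset open_W in auto)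
    then show "norm (deriv g (\<zeta> (of_real t)) * deriv \<zeta> (of_real t)) \<le> M"
      using r2(2)[OF tr(3), of w] w by simp
  qed
  moreover have "r > 0" using r1 r2 t1b by (simp add: r_def)
  ultimately show "\<exists>t1 r M. 0 < r \<and> 0 < t1 \<and> t1 \<le> 1 \<and> \<zeta> (of_real t1) \<notin> U \<and>
     (\<forall>t. t1 - r < t \<longrightarrow> t < t1 \<longrightarrow>
       \<zeta> (of_real t) \<in> U \<and> norm (deriv g (\<zeta> (of_real t)) * deriv \<zeta> (of_real t)) \<le> M)"
    using t1b by blast
qed

end

section \<open>Holomorphic functions of two variables and vertical fibers\<close>

definition holomorphic2_at :: "(complex \<times> complex \<Rightarrow> complex) \<Rightarrow> complex \<times> complex \<Rightarrow> bool"
  where "holomorphic2_at f p \<longleftrightarrow> (\<exists>A B. (f has_derivative (\<lambda>(h, k). A * h + B * k)) (at p))"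

lemma holomorphic2_atI: "(f has_derivative (\<lambda>(h, k). A * h + B * k)) (at p) \<Longrightarrow> holomorphic2_at f p"
  unfolding holomorphic2_at_def by (rule exI, rule exI)

lemma holomorphic2_atE:
  assumes "holomorphic2_at f p"
  obtains A B where "(f has_derivative (\<lambda>(h, k). A * h + B * k)) (at p)"
  using assms unfolding holomorphic2_at_def by (elim exE)

lemma holomorphic2_on_open:
  assumes "open S"
  shows "f holomorphic2_on S \<longleftrightarrow> (\<forall>p\<in>S. holomorphic2_at f p)"
  unfolding holomorphic2_on_def holomorphic2_at_def using assms by (intro ball_cong refl) (simp only: at_within_open)

lemma holomorphic2_at_fst [simp]: "holomorphic2_at fst p"
  and holomorphic2_at_snd [simp]: "holomorphic2_at snd p"
proof -
  have "(\<lambda>(h, k). 1 * h + 0 * k) = (fst :: complex \<times> complex \<Rightarrow> complex)"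
    "(\<lambda>(h, k). 0 * h + 1 * k) = (snd :: complex \<times> complex \<Rightarrow> complex)"
    by (simp_all add: fun_eq_iff)
  then have *: "(fst has_derivative (\<lambda>(h, k). 1 * h + 0 * k)) (at p)"
    "(snd has_derivative (\<lambda>(h, k). 0 * h + 1 * k)) (at p)"
    by (simp_all add: bounded_linear_fst bounded_linear_snd bounded_linear_imp_has_derivative)
  show "holomorphic2_at fst p" "holomorphic2_at snd p"
    by (rule holomorphic2_atI[OF *(1)], rule holomorphic2_atI[OF *(2)])
qed

lemma holomorphic2_at_add:
  assumes "holomorphic2_at f p" "holomorphic2_at h p"
  shows "holomorphic2_at (\<lambda>q. f q + h q) p"
proof -
  obtain A B where d: "(f has_derivative (\<lambda>(h, k). A * h + B * k)) (at p)"
    using assms(1) by (rule holomorphic2_atE)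
  obtain A' B' where d': "(h has_derivative (\<lambda>(h, k). A' * h + B' * k)) (at p)"
    using assms(2) by (rule holomorphic2_atE)
  have "(\<lambda>q. (\<lambda>(h, k). A * h + B * k) q + (\<lambda>(h, k). A' * h + B' * k) q) = (\<lambda>(h, k). (A + A') * h + (B + B') * k)"
    by (auto simp: fun_eq_iff algebra_simps)
  with has_derivative_add[OF d d'] have "((\<lambda>q. f q + h q) has_derivative (\<lambda>(h, k). (A + A') * h + (B + B') * k)) (at p)"
    by simp
  then show ?thesis by (rule holomorphic2_atI)
qed

lemma holomorphic2_at_compose:
  assumes "holomorphic2_at f p" "h field_differentiable at (f p)"
  shows "holomorphic2_at (\<lambda>q. h (f q)) p"
proof -
  obtain A B where d: "(f has_derivative (\<lambda>(h, k). A * h + B * k)) (at p)"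
    using assms(1) by (rule holomorphic2_atE)
  obtain D where D: "(h has_field_derivative D) (at (f p))"
    using assms(2) unfolding field_differentiable_def by (elim exE)
  have "(\<lambda>q. D * (\<lambda>(h, k). A * h + B * k) q) = (\<lambda>(h, k). (D * A) * h + (D * B) * k)"
    by (auto simp: fun_eq_iff algebra_simps)
  moreover have "((\<lambda>q. h (f q)) has_derivative (\<lambda>q. D * (\<lambda>(h, k). A * h + B * k) q)) (at p)"
    using has_derivative_compose[OF d] D by (simp add: has_field_derivative_def)
  ultimately have "((\<lambda>q. h (f q)) has_derivative (\<lambda>(h, k). (D * A) * h + (D * B) * k)) (at p)"
    by simp
  then show ?thesis by (rule holomorphic2_atI)
qed

lemma holomorphic2_at_diff:
  assumes "holomorphic2_at f p" "holomorphic2_at h p"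
  shows "holomorphic2_at (\<lambda>q. f q - h q) p"
proof -
  have "(\<lambda>z::complex. - z) field_differentiable at (h p)"
    by (auto simp: field_differentiable_def intro!: derivative_eq_intros)
  then have "holomorphic2_at (\<lambda>q. - h q) p"
    by (rule holomorphic2_at_compose[OF assms(2)])
  from holomorphic2_at_add[OF assms(1) this] show ?thesis by simp
qed

lemma holomorphic2_at_curve:
  assumes f: "holomorphic2_at f (a t, b t)" and a: "a field_differentiable at t" and b: "b field_differentiable at t"
  shows "(\<lambda>t. f (a t, b t)) field_differentiable at t"
proof -
  obtain A B where d: "(f has_derivative (\<lambda>(h, k). A * h + B * k)) (at (a t, b t))"
    using f by (rule holomorphic2_atE)
  obtain a' where a': "(a has_field_derivative a') (at t)"
    using a unfolding field_differentiable_def by (elim exE)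
  obtain b' where b': "(b has_field_derivative b') (at t)"
    using b unfolding field_differentiable_def by (elim exE)
  have "((\<lambda>t. (a t, b t)) has_derivative (\<lambda>h. (a' * h, b' * h))) (at t)"
    using a' b' unfolding has_field_derivative_def by (rule has_derivative_Pair)
  from has_derivative_compose[OF this d]
  have "((\<lambda>t. f (a t, b t)) has_derivative (\<lambda>h. A * (a' * h) + B * (b' * h))) (at t)"
    by simp
  moreover have "(\<lambda>h. A * (a' * h) + B * (b' * h)) = (*) (A * a' + B * b')"
    by (simp add: fun_eq_iff algebra_simps)
  ultimately have "((\<lambda>t. f (a t, b t)) has_field_derivative (A * a' + B * b')) (at t)"
    by (simp add: has_field_derivative_def)
  then show ?thesis
    unfolding field_differentiable_def by (rule exI)
qed

lemma holomorphic2_at_transform: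
  assumes "holomorphic2_at f p" "open S" "p \<in> S" "\<And>q. q \<in> S \<Longrightarrow> f q = h q"
  shows "holomorphic2_at h p"
proof -
  obtain A B where "(f has_derivative (\<lambda>(h, k). A * h + B * k)) (at p)"
    using assms(1) by (rule holomorphic2_atE)
  from has_derivative_transform_within_open[OF this assms(2-4)] show ?thesis
    by (rule holomorphic2_atI)
qed

text \<open>Invariance of domain provides both the open image and the continuous inverse.\<close>

lemma is_chart_injective:
  fixes \<phi> :: "'a::euclidean_space \<Rightarrow> 'a"
  assumes V: "open V" "V \<subseteq> S" and \<phi>: "continuous_on V \<phi>" "inj_on \<phi> V"
  shows "is_chart (top_of_set S) (V, \<phi>)"
proof -
  obtain h where "homeomorphism V (\<phi> ` V) \<phi> h"
    using invariance_of_domain_homeomorphism[OF V(1) \<phi>(1) _ \<phi>(2)] by blast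
  then have "homeomorphic_maps (top_of_set V) (top_of_set (\<phi> ` V)) \<phi> h"
    by (auto simp: homeomorphic_maps_def homeomorphism_def)
  then have "homeomorphic_map (top_of_set V) (top_of_set (\<phi> ` V)) \<phi>"
    using homeomorphic_maps_map by blast
  moreover have "S \<inter> V = V" using V by blast
  moreover have "openin (top_of_set S) V" using V by (auto simp: openin_open)
  moreover have "open (\<phi> ` V)" using invariance_of_domain \<phi> V by blast
  ultimately show ?thesis
    by (simp add: is_chart_def subtopology_subtopology)
qed

lemma Hausdorff_second_countable_top_of_set:
  fixes S :: "'a::euclidean_space set"
  shows "Hausdorff_space (top_of_set S)" "second_countable (top_of_set S)"
proof -
  obtain \<B> :: "'a set set" where \<B>: "countable \<B>" "\<And>C. C \<in> \<B> \<Longrightarrow> open C"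
      "\<And>S. open S \<Longrightarrow> \<exists>\<U>. \<U> \<subseteq> \<B> \<and> S = \<Union>\<U>"
    using univ_second_countable by blast
  have "\<exists>V\<in>\<B>. x \<in> V \<and> V \<subseteq> U" if "open U" "x \<in> U" for x U
    using \<B>(3)[OF that(1)] that(2) by blast
  then have "second_countable (euclidean :: 'a topology)"
    unfolding second_countable_def using \<B> by (intro exI[of _ \<B>]) auto
  then show "second_countable (top_of_set S)" by (rule second_countable_subtopology)
  show "Hausdorff_space (top_of_set S)" by (simp add: Hausdorff_space_subtopology)
qed

text \<open>The second coordinate identifies \<open>{z} \<times> F\<close> with \<open>F\<close>; all charts that are holomorphic and
  injective in it are then compatible, because injective holomorphic functions have holomorphic inverses.\<close>

lemma vertical_domain:
  fixes \<B> :: "(complex \<times> complex, complex) chart set"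
  assumes F: "open F" "connected F"
    and op: "\<And>V \<psi>. (V, \<psi>) \<in> \<B> \<Longrightarrow> openin (top_of_set ({z} \<times> F)) V"
    and hol: "\<And>V \<psi>. (V, \<psi>) \<in> \<B> \<Longrightarrow> (\<lambda>u. \<psi> (z, u)) holomorphic_on {u. (z, u) \<in> V}"
    and inj: "\<And>V \<psi>. (V, \<psi>) \<in> \<B> \<Longrightarrow> inj_on \<psi> V"
    and cover: "(\<Union>c\<in>\<B>. fst c) = {z} \<times> F"
  shows "riemann_surface (top_of_set ({z} \<times> F)) \<B>"
    and "biholomorphic_to_domain (top_of_set ({z} \<times> F)) \<B> F"
proof -
  let ?T = "top_of_set ({z} \<times> F)"
  define D :: "(complex \<times> complex) set \<Rightarrow> complex set" where "D V = {u. (z, u) \<in> V}" for V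
  have V_eq: "V = {z} \<times> D V" and D_sub: "D V \<subseteq> F" and D_open: "open (D V)" if c: "(V, \<psi>) \<in> \<B>" for V \<psi>
  proof -
    obtain O' where O': "open O'" "V = ({z} \<times> F) \<inter> O'"
      using op[OF c] by (auto simp: openin_open)
    then show "V = {z} \<times> D V" "D V \<subseteq> F" by (auto simp: D_def)
    have "D V = F \<inter> Pair z -` O'" using O' by (auto simp: D_def)
    moreover have "open (Pair z -` O')"
      using O'(1) by (intro open_vimage continuous_intros)
    ultimately show "open (D V)" using F by auto
  qed
  have V_mem: "fst x = z \<and> snd x \<in> D V" if "(V, \<psi>) \<in> \<B>" "x \<in> V" for V \<psi> x
  proof -
    have "x \<in> {z} \<times> D V" using that by (simp flip: V_eq)
    then show ?thesis by auto
  qed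
  have V_pair: "(z, snd x) = x" if "(V, \<psi>) \<in> \<B>" "x \<in> V" for V \<psi> x
    using V_mem[OF that] by (cases x) auto
  have inv: "\<exists>h. h holomorphic_on \<psi> ` V \<and> (\<forall>x\<in>V. h (\<psi> x) = snd x)" if c: "(V, \<psi>) \<in> \<B>" for V \<psi>
  proof -
    have "inj_on (\<lambda>u. \<psi> (z, u)) (D V)"
      using inj[OF c] by (auto simp: inj_on_def D_def)
    moreover have "(\<lambda>u. \<psi> (z, u)) holomorphic_on D V" using hol[OF c] by (simp add: D_def)
    ultimately obtain h where h: "h holomorphic_on (\<lambda>u. \<psi> (z, u)) ` D V" "\<And>u. u \<in> D V \<Longrightarrow> h (\<psi> (z, u)) = u"
      using holomorphic_has_inverse[OF _ D_open[OF c]] by metis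
    have "\<psi> ` V = (\<lambda>u. \<psi> (z, u)) ` D V" by (subst V_eq[OF c]) auto
    moreover have "h (\<psi> x) = snd x" if x: "x \<in> V" for x
      using h(2)[of "snd x"] V_mem[OF c x] V_pair[OF c x] by simp
    ultimately show ?thesis using h(1) by auto
  qed
  have inv_into: "inv_into V \<psi> (\<psi> x) = x" if "(V, \<psi>) \<in> \<B>" "x \<in> V" for V \<psi> x
    using inj[OF that(1)] that(2) by (rule inv_into_f_f)
  have opn: "open (\<psi> ` ({z} \<times> D'))" if c: "(V, \<psi>) \<in> \<B>" "open D'" "D' \<subseteq> D V" for V \<psi> D'
  proof -
    have "(\<lambda>u. \<psi> (z, u)) holomorphic_on D'"
      using hol[OF c(1)] c by (auto simp: D_def intro: holomorphic_on_subset)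
    moreover have "inj_on (\<lambda>u. \<psi> (z, u)) D'"
      using inj[OF c(1)] c by (force simp: inj_on_def D_def)
    ultimately have "open ((\<lambda>u. \<psi> (z, u)) ` D')"
      using c(2) by (intro invariance_of_domain holomorphic_on_imp_continuous_on)
    moreover have "\<psi> ` ({z} \<times> D') = (\<lambda>u. \<psi> (z, u)) ` D'" by auto
    ultimately show ?thesis by simp
  qed
  have chart: "is_chart ?T (V, \<psi>)" if c: "(V, \<psi>) \<in> \<B>" for V \<psi>
  proof -
    obtain h where h: "h holomorphic_on \<psi> ` V" "\<And>x. x \<in> V \<Longrightarrow> h (\<psi> x) = snd x"
      using inv[OF c] by blast
    have "continuous_on V (\<lambda>x. (\<lambda>u. \<psi> (z, u)) (snd x))"
    proof (rule continuous_on_compose2[where g = "\<lambda>u. \<psi> (z, u)" and f = snd and t = "D V"])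
      show "continuous_on (D V) (\<lambda>u. \<psi> (z, u))"
        using hol[OF c] by (simp add: D_def holomorphic_on_imp_continuous_on)
    qed (use V_mem[OF c] in \<open>auto intro!: continuous_intros\<close>)
    moreover have "\<psi> (z, snd x) = \<psi> x" if "x \<in> V" for x
      using V_pair[OF c that] by simp
    ultimately have "continuous_on V \<psi>" by (rule continuous_on_eq)
    moreover have "continuous_on (\<psi> ` V) (\<lambda>y. (z, h y))"
      using h(1) by (intro continuous_intros holomorphic_on_imp_continuous_on)
    moreover have "(z, h (\<psi> x)) = x" if x: "x \<in> V" for x
      using h(2)[OF x] V_pair[OF c x] by simp
    ultimately have "homeomorphic_maps (top_of_set V) (top_of_set (\<psi> ` V)) \<psi> (\<lambda>y. (z, h y))"
      by (auto simp: homeomorphic_maps_def continuous_map_in_subtopology)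
    then have "homeomorphic_map (top_of_set V) (top_of_set (\<psi> ` V)) \<psi>"
      using homeomorphic_maps_map by blast
    moreover have "{z} \<times> F \<inter> V = V" using openin_imp_subset[OF op[OF c]] by blast
    moreover have "open (\<psi> ` V)" using opn[OF c D_open[OF c] order_refl] unfolding V_eq[OF c, symmetric] .
    ultimately show ?thesis
      using op[OF c] by (simp add: is_chart_def subtopology_subtopology)
  qed
  have trans: "(\<psi> \<circ> inv_into V \<phi>) holomorphic_on \<phi> ` (V \<inter> W)" if c: "(V, \<phi>) \<in> \<B>" and d: "(W, \<psi>) \<in> \<B>" for V \<phi> W \<psi>
  proof -
    obtain h where h: "h holomorphic_on \<phi> ` V" "\<And>x. x \<in> V \<Longrightarrow> h (\<phi> x) = snd x"
      using inv[OF c] by blast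
    have hp: "(z, h (\<phi> x)) = x" if x: "x \<in> V" for x
      using h(2)[OF x] V_pair[OF c x] by simp
    have "((\<lambda>u. \<psi> (z, u)) \<circ> h) holomorphic_on \<phi> ` (V \<inter> W)"
    proof (rule holomorphic_on_compose)
      show "h holomorphic_on \<phi> ` (V \<inter> W)" by (rule holomorphic_on_subset[OF h(1)]) auto
      show "(\<lambda>u. \<psi> (z, u)) holomorphic_on h ` \<phi> ` (V \<inter> W)"
        by (rule holomorphic_on_subset[OF hol[OF d]]) (auto simp: hp)
    qed
    then show ?thesis
      by (rule holomorphic_transform) (auto simp: hp inv_into[OF c])
  qed
  have comp: "compatible_charts (holomorphic_on) c d" if "c \<in> \<B>" "d \<in> \<B>" for c d
    using that trans[of "fst c" "snd c" "fst d" "snd d"] trans[of "fst d" "snd d" "fst c" "snd c"]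
    by (simp add: compatible_charts_def case_prod_unfold Int_commute)
  have "connected ({z} \<times> F)" using F by (intro connected_Times) auto
  then show "riemann_surface ?T \<B>"
    unfolding riemann_surface_def complex_manifold_def
    using Hausdorff_second_countable_top_of_set[of "{z} \<times> F"] chart comp cover
    by (simp add: connected_space_subtopology split_paired_all)
  have hm: "homeomorphic_maps ?T (top_of_set F) snd (Pair z)"
    by (auto simp: homeomorphic_maps_def continuous_map_in_subtopology intro!: continuous_intros)
  show "biholomorphic_to_domain ?T \<B> F"
    unfolding biholomorphic_to_domain_def
  proof (intro exI[of _ snd] conjI ballI)
    show "homeomorphic_map ?T (top_of_set F) snd" using hm homeomorphic_maps_map by blast
    fix c assume "c \<in> \<B>"
    then obtain V \<psi> where c: "c = (V, \<psi>)" "(V, \<psi>) \<in> \<B>" by (cases c) auto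
    obtain h where h: "h holomorphic_on \<psi> ` V" "\<And>x. x \<in> V \<Longrightarrow> h (\<psi> x) = snd x"
      using inv[OF c(2)] by blast
    have "(snd \<circ> inv_into V \<psi>) holomorphic_on \<psi> ` V"
      by (rule holomorphic_transform[OF h(1)]) (auto simp: h(2) inv_into[OF c(2)])
    moreover have "(\<psi> \<circ> inv_into (topspace ?T) snd) holomorphic_on snd ` V"
    proof (rule holomorphic_transform)
      show "(\<lambda>u. \<psi> (z, u)) holomorphic_on snd ` V"
      proof (rule holomorphic_on_subset[OF hol[OF c(2)]], rule image_subsetI)
        show "snd x \<in> {u. (z, u) \<in> V}" if "x \<in> V" for x
          using V_pair[OF c(2) that] that by simp
      qed
      have *: "inv_into ({z} \<times> F) snd u = (z, u)" if "u \<in> F" for u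
        by (rule inv_into_f_eq) (use that in \<open>auto simp: inj_on_def\<close>)
      fix u assume "u \<in> snd ` V"
      then have "u \<in> F" using openin_imp_subset[OF op[OF c(2)]] by auto
      then show "\<psi> (z, u) = (\<psi> \<circ> inv_into (topspace ?T) snd) u" by (simp add: *)
    qed
    ultimately show "case c of (V, \<psi>) \<Rightarrow> (snd \<circ> inv_into V \<psi>) holomorphic_on \<psi> ` V \<and>
        (\<psi> \<circ> inv_into (topspace ?T) snd) holomorphic_on snd ` V"
      by (simp add: c)
  qed
qed

section \<open>Homology of loops\<close>

text \<open>Every class of \<open>X\<close> is recovered by pushing it to \<open>Y\<close> and back,
  and in \<open>Y\<close> it is trivial.\<close>

lemma trivial_homology_group_retract:
  assumes f: "continuous_map X Y f" and h: "continuous_map Y X h"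
    and hf: "\<And>x. x \<in> topspace X \<Longrightarrow> h (f x) = x"
    and Y: "trivial_group (homology_group p Y)"
  shows "trivial_group (homology_group p X)"
proof -
  have "c = \<one>\<^bsub>homology_group p X\<^esub>" if c: "c \<in> carrier (homology_group p X)" for c
  proof -
    have "hom_induced p Y {} X {} h (hom_induced p X {} Y {} f c) = hom_induced p X {} X {} (h \<circ> f) c"
      using f h by (intro hom_induced_compose') auto
    also have "\<dots> = c"
      using c hf continuous_map_compose[OF f h] by (intro hom_induced_id_gen) auto
    finally have "c = hom_induced p Y {} X {} h (hom_induced p X {} Y {} f c)" by simp
    also have "hom_induced p X {} Y {} f c \<in> carrier (homology_group p Y)"
      by (rule hom_induced_carrier)
    then have "hom_induced p X {} Y {} f c = \<one>\<^bsub>homology_group p Y\<^esub>"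
      using Y by (simp add: trivial_group_def)
    also have "hom_induced p Y {} X {} h \<one>\<^bsub>homology_group p Y\<^esub> = \<one>\<^bsub>homology_group p X\<^esub>"
      by (intro hom_one[OF hom_induced_hom]) auto
    finally show ?thesis .
  qed
  then show ?thesis
    unfolding trivial_group_def using group.is_monoid[of "homology_group p X"] monoid.one_closed
    by (auto simp: group_relative_homology_group)
qed

lemma nontrivial_homology_group_circle:
  "\<not> trivial_group (homology_group 1 (top_of_set (sphere (0::complex) 1)))"
proof
  assume t: "trivial_group (homology_group 1 (top_of_set (sphere (0::complex) 1)))"
  obtain f :: "(nat \<Rightarrow> real) \<Rightarrow> complex" and h
    where "homeomorphic_maps (nsphere (2 - 1)) (top_of_set (sphere 0 1 \<inter> span Basis)) f h"
    using homeomorphic_maps_nsphere_euclidean_sphere[of "Basis :: complex set" 2]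
      independent_Basis orthogonal_Basis norm_Basis by (auto simp: DIM_complex)
  then have "homeomorphic_maps (nsphere 1) (top_of_set (sphere 0 1)) f h"
    by simp
  then have "trivial_group (homology_group 1 (nsphere 1))"
    by (intro trivial_homology_group_retract[OF _ _ _ t, of _ f h]) (auto simp: homeomorphic_maps_def)
  then show False
    using trivial_reduced_homology_group_nsphere[of 1 1] by (simp add: un_reduced_homology_group)
qed

text \<open>The loop is the image under \<open>d\<close> of the boundary circle of the disk, and the
  first homology of a contractible space vanishes.\<close>

lemma loop_cycle_null_homologous:
  assumes d: "continuous_map (top_of_set (cball 0 1)) T d"
    and eq: "\<And>w. w \<in> sphere 0 1 \<Longrightarrow> d w = \<gamma> w"
  shows "singular_relboundary 1 T {} (loop_cycle \<gamma>)"
proof -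
  let ?B = "top_of_set (cball (0::complex) 1)"
  define \<sigma> where "\<sigma> = restrict (\<lambda>t. cis (2 * pi * t 1)) (standard_simplex 1)"
  have sim: "singular_simplex 1 ?B \<sigma>"
  proof -
    have "continuous_map (subtopology (powertop_real UNIV) (standard_simplex 1)) euclideanreal (\<lambda>x. x 1)"
      by (metis (mono_tags) UNIV_I continuous_map_from_subtopology continuous_map_product_projection)
    moreover have "continuous_map euclideanreal ?B (\<lambda>t. cis (2 * pi * t))"
      by (auto simp: continuous_map_in_subtopology intro!: continuous_intros)
    ultimately have "continuous_map (subtopology (powertop_real UNIV) (standard_simplex 1)) ?B
        ((\<lambda>t. cis (2 * pi * t)) \<circ> (\<lambda>x. x 1))"
      by (rule continuous_map_compose)
    then have "continuous_map (subtopology (powertop_real UNIV) (standard_simplex 1)) ?B \<sigma>"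
      by (rule continuous_map_eq) (auto simp: \<sigma>_def)
    then show ?thesis by (simp add: singular_simplex_def \<sigma>_def)
  qed
  have "chain_boundary 1 (frag_of \<sigma>) = 0"
  proof -
    \<comment> \<open>The two endpoints of the path are \<open>cis (2 * pi)\<close> and
      \<open>cis 0\<close>, which coincide.\<close>
    have "singular_face 1 0 \<sigma> = singular_face 1 1 \<sigma>"
      by (auto simp: singular_face_def \<sigma>_def fun_eq_iff restrict_def simplical_face_def standard_simplex_0
          simplical_face_in_standard_simplex standard_simplex_def)
    then show ?thesis
      by (simp add: chain_boundary_of)
  qed
  then have cyc: "singular_relcycle 1 ?B {} (frag_of \<sigma>)"
    using sim by (simp add: singular_cycle singular_chain_of)
  have "contractible_space ?B"
    by (simp add: convex_imp_contractible contractible_space_top_of_set)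
  then have "trivial_group (homology_group 1 ?B)"
    using trivial_reduced_homology_group_contractible_space[of ?B 1] by (simp add: un_reduced_homology_group)
  moreover have "homologous_rel_set 1 ?B {} (frag_of \<sigma>) \<in> carrier (homology_group 1 ?B)"
    using carrier_relative_homology_group[of 1 ?B "{}"] cyc by auto
  ultimately have "homologous_rel_set 1 ?B {} (frag_of \<sigma>) = singular_relboundary_set 1 ?B {}"
    using one_relative_homology_group[of 1 ?B "{}"] by (simp add: trivial_group_def)
  then have "singular_relboundary 1 ?B {} (frag_of \<sigma>)"
    by (simp add: homologous_rel_set_eq_relboundary)
  then have "singular_relboundary 1 T {} (chain_map 1 d (frag_of \<sigma>))"
    using d by (intro singular_relboundary_chain_map) auto
  moreover have "chain_map 1 d (frag_of \<sigma>) = loop_cycle \<gamma>"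
    unfolding loop_cycle_def chain_map_of
    by (intro arg_cong[where f = frag_of]) (auto simp: simplex_map_def \<sigma>_def fun_eq_iff eq)
  ultimately show ?thesis by simp
qed

text \<open>If the generating class were zero, the first homology of \<open>T\<close> would vanish,
  and so would that of the circle, which is a retract of \<open>T\<close>.\<close>

lemma circle_around_puncture_not_null:
  assumes r: "continuous_map (top_of_set (sphere 0 1)) T i" "continuous_map T (top_of_set (sphere (0::complex) 1)) r"
      "\<And>s. s \<in> sphere 0 1 \<Longrightarrow> r (i s) = s"
    and \<gamma>: "circle_around_puncture T \<B> \<gamma>"
  shows "\<not> singular_relboundary 1 T {} (loop_cycle \<gamma>)"
proof
  assume "singular_relboundary 1 T {} (loop_cycle \<gamma>)"
  then have "homologous_rel_set 1 T {} (loop_cycle \<gamma>) = \<one>\<^bsub>homology_group 1 T\<^esub>"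
    using one_relative_homology_group[of 1 T "{}"] by (simp add: homologous_rel_set_eq_relboundary)
  then have "carrier (homology_group 1 T) = {\<one>\<^bsub>homology_group 1 T\<^esub>}"
    using \<gamma> group.generate_one[OF group_relative_homology_group, of 1 T "{}"]
    by (simp add: circle_around_puncture_def)
  then have "trivial_group (homology_group 1 T)"
    by (simp add: trivial_group_def)
  then have "trivial_group (homology_group 1 (top_of_set (sphere (0::complex) 1)))"
    by (rule trivial_homology_group_retract[OF r(1,2), rotated]) (use r(3) in auto)
  then show False by (simp add: nontrivial_homology_group_circle)
qed

section \<open>The twisted bidisk\<close>

definition square_chart :: "(complex \<Rightarrow> complex) \<Rightarrow> complex \<times> complex \<Rightarrow> complex \<times> complex"
  where "square_chart g = (\<lambda>(b, u). (b, u\<^sup>2 - g b))"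

text \<open>The factor \<open>c\<close> rotates a half plane onto the right half plane, where
  squaring is injective with inverse \<open>csqrt\<close>; this makes \<open>square_chart\<close>
  injective. For \<open>c = 0\<close> the set is empty.\<close>

definition half_bidisk :: "complex \<Rightarrow> (complex \<times> complex) set"
  where "half_bidisk c = {(b, u). b \<in> ball 0 1 \<and> u \<in> ball 0 1 \<and> 0 < Re (c * u)}"

definition twisted_bidisk :: "complex set \<Rightarrow> (complex \<times> complex) set"
  where "twisted_bidisk U = {(b, u). b \<in> ball 0 1 \<and> u \<in> ball 0 1 \<and> (b \<notin> U \<longrightarrow> u \<noteq> 0)}"

text \<open>The square charts cover everything with \<open>u \<noteq> 0\<close>; the identity chart
  adds the points with \<open>u = 0\<close>, which exist only over \<open>U\<close>.\<close>

definition twisted_atlas ::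
    "complex set \<Rightarrow> (complex \<Rightarrow> complex) \<Rightarrow> (complex \<times> complex, complex \<times> complex) chart set"
  where "twisted_atlas U g = insert (U \<times> ball 0 1, id) (range (\<lambda>c. (half_bidisk c, square_chart g)))"

lemma csqrt_power2: "0 < Re a \<Longrightarrow> csqrt (a\<^sup>2) = a"
  by (intro csqrt_unique) auto

lemma power2_notin_nonpos_Reals: "0 < Re a \<Longrightarrow> a\<^sup>2 \<notin> \<real>\<^sub>\<le>\<^sub>0"
proof
  assume a: "0 < Re a" "a\<^sup>2 \<in> \<real>\<^sub>\<le>\<^sub>0"
  then have "Im (a\<^sup>2) = 0" "Re (a\<^sup>2) \<le> 0" by (auto simp: complex_nonpos_Reals_iff)
  then have "Im a = 0" "(Re a)\<^sup>2 \<le> 0" using a(1) by (auto simp: Im_power2 Re_power2)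
  then show False using a(1) by simp
qed

locale twisted_bidisk_surface =
  fixes U :: "complex set" and g :: "complex \<Rightarrow> complex"
  assumes U: "open U" "U \<subseteq> ball 0 1"
    and g: "continuous_on UNIV g" "g holomorphic_on U"
begin

abbreviation "S \<equiv> twisted_bidisk U"
abbreviation "X \<equiv> top_of_set S"
abbreviation "\<A> \<equiv> twisted_atlas U g"

section \<open>The complex structure of the twisted bidisk\<close>

lemma atlas_cases:
  assumes "(V, \<phi>) \<in> \<A>"
  obtains "V = U \<times> ball 0 1" "\<phi> = id" | c where "V = half_bidisk c" "\<phi> = square_chart g"
  using assms by (auto simp: twisted_atlas_def)

lemma open_half_bidisk: "open (half_bidisk c)"
proof -
  have "half_bidisk c = (ball 0 1 \<times> ball 0 1) \<inter> {p. 0 < Re (c * snd p)}"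
    by (auto simp: half_bidisk_def)
  moreover have "open {p :: complex \<times> complex. 0 < Re (c * snd p)}"
    by (intro open_Collect_less continuous_intros)
  ultimately show ?thesis by (auto intro!: open_Int open_Times)
qed

lemma atlas_open: "(V, \<phi>) \<in> \<A> \<Longrightarrow> open V"
  by (elim atlas_cases) (use U open_half_bidisk in \<open>auto intro!: open_Times\<close>)

lemma atlas_subset: "(V, \<phi>) \<in> \<A> \<Longrightarrow> V \<subseteq> S"
  by (elim atlas_cases) (use U in \<open>auto simp: half_bidisk_def twisted_bidisk_def\<close>)

lemma atlas_cover: "(\<Union>c\<in>\<A>. fst c) = S"
proof (intro equalityI subsetI)
  fix p assume p: "p \<in> S"
  obtain b u where bu: "p = (b, u)" by (cases p)
  show "p \<in> (\<Union>c\<in>\<A>. fst c)"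
  proof (cases "u = 0")
    case True
    then have "p \<in> U \<times> ball 0 1" using p bu by (auto simp: twisted_bidisk_def)
    then show ?thesis by (auto simp: twisted_atlas_def)
  next
    case False
    \<comment> \<open>Multiplying by \<open>cnj u\<close> rotates \<open>u\<close> to the positive
      real axis, so the half plane is centred at the point itself.\<close>
    then have "0 < Re (cnj u * u)" by (simp add: complex_neq_0 flip: power2_eq_square)
    then have "p \<in> half_bidisk (cnj u)" using p bu by (auto simp: twisted_bidisk_def half_bidisk_def)
    then show ?thesis by (auto simp: twisted_atlas_def)
  qed
next
  fix p assume "p \<in> (\<Union>c\<in>\<A>. fst c)"
  then show "p \<in> S" using atlas_subset by fastforce
qed

lemma open_S: "open S"
  unfolding atlas_cover[symmetric] using atlas_open by (intro open_UN) auto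

lemma atlas_fst: "(V, \<phi>) \<in> \<A> \<Longrightarrow> fst (\<phi> x) = fst x"
  by (elim atlas_cases) (auto simp: square_chart_def case_prod_unfold)

lemma atlas_continuous: "(V, \<phi>) \<in> \<A> \<Longrightarrow> continuous_on A \<phi>"
proof (elim atlas_cases)
  assume "\<phi> = square_chart g"
  moreover have "continuous_on A (\<lambda>p. (fst p, (snd p)\<^sup>2 - g (fst p)))"
    by (intro continuous_intros continuous_on_compose2[OF g(1)]) auto
  ultimately show ?thesis by (simp add: square_chart_def case_prod_unfold)
qed auto

text \<open>An explicit inverse: \<open>csqrt\<close> of \<open>(c * u)\<^sup>2\<close> is
  \<open>c * u\<close> because this has positive real part.\<close>

lemma square_chart_root:
  assumes "p \<in> half_bidisk c" and q: "q = square_chart g p"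
  shows "p = (fst q, csqrt (c\<^sup>2 * (snd q + g (fst q))) / c)"
proof -
  obtain b u where p: "p = (b, u)" by (cases p)
  then have c: "0 < Re (c * u)" using assms by (simp add: half_bidisk_def)
  then have "csqrt (c\<^sup>2 * u\<^sup>2) = c * u" using csqrt_power2[of "c * u"] by (simp add: power_mult_distrib)
  moreover have "c \<noteq> 0" using c by auto
  ultimately show ?thesis using q p by (simp add: square_chart_def)
qed

lemma atlas_inj: "(V, \<phi>) \<in> \<A> \<Longrightarrow> inj_on \<phi> V"
proof (elim atlas_cases)
  fix c assume "V = half_bidisk c" "\<phi> = square_chart g"
  then show ?thesis
    by (intro inj_on_inverseI[where g = "\<lambda>q. (fst q, csqrt (c\<^sup>2 * (snd q + g (fst q))) / c)"])
      (simp add: square_chart_root[symmetric])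
qed auto

lemma atlas_is_chart: "(V, \<phi>) \<in> \<A> \<Longrightarrow> is_chart X (V, \<phi>)"
  by (intro is_chart_injective atlas_open atlas_subset atlas_continuous atlas_inj)

lemma atlas_image_open: "(V, \<phi>) \<in> \<A> \<Longrightarrow> open V' \<Longrightarrow> V' \<subseteq> V \<Longrightarrow> open (\<phi> ` V')"
  by (intro invariance_of_domain atlas_continuous inj_on_subset[OF atlas_inj])

lemma g_diff: "b \<in> U \<Longrightarrow> g field_differentiable at b"
  using g U by (simp add: holomorphic_on_imp_differentiable_at)

lemma holomorphic2_at_square:
  assumes "fst p \<in> U"
  shows "holomorphic2_at (\<lambda>p. snd (square_chart g p)) p"
proof -
  have "holomorphic2_at (\<lambda>p. (snd p)\<^sup>2) p"
    by (rule holomorphic2_at_compose[of snd])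
      (auto simp: field_differentiable_def intro!: exI derivative_eq_intros)
  moreover have "holomorphic2_at (\<lambda>p. g (fst p)) p"
    by (rule holomorphic2_at_compose[OF holomorphic2_at_fst g_diff[OF assms]])
  ultimately show ?thesis
    unfolding square_chart_def case_prod_unfold by (simp add: holomorphic2_at_diff)
qed

text \<open>The square of a number with positive real part avoids the branch cut of
  \<open>csqrt\<close>.\<close>

lemma holomorphic2_at_square_root:
  assumes p: "p \<in> half_bidisk c" and "fst p \<in> U"
  shows "holomorphic2_at (\<lambda>q. csqrt (c\<^sup>2 * (snd q + g (fst q))) / c) (square_chart g p)"
proof -
  obtain b u where bu: "p = (b, u)" by (cases p)
  have pos: "0 < Re (c * u)" using p bu by (simp add: half_bidisk_def)
  let ?q = "square_chart g p"
  have "fst ?q \<in> U" "snd ?q + g (fst ?q) = u\<^sup>2" using assms bu by (auto simp: square_chart_def)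
  have "holomorphic2_at (\<lambda>q. snd q + g (fst q)) ?q"
    by (rule holomorphic2_at_add[OF holomorphic2_at_snd
        holomorphic2_at_compose[OF holomorphic2_at_fst g_diff[OF \<open>fst ?q \<in> U\<close>]]])
  moreover have "(\<lambda>y. csqrt (c\<^sup>2 * y) / c) field_differentiable at (snd ?q + g (fst ?q))"
  proof -
    have "c\<^sup>2 * u\<^sup>2 \<notin> \<real>\<^sub>\<le>\<^sub>0"
      using power2_notin_nonpos_Reals[OF pos] by (simp add: power_mult_distrib)
    then have "csqrt field_differentiable at (c\<^sup>2 * u\<^sup>2)"
      by (rule field_differentiable_at_csqrt)
    then have "(\<lambda>y. csqrt (c\<^sup>2 * y)) field_differentiable at (u\<^sup>2)"
      by (intro field_differentiable_compose[of "\<lambda>y. c\<^sup>2 * y" _ csqrt, unfolded o_def]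
          field_differentiable_mult field_differentiable_const field_differentiable_ident) auto
    moreover have "c \<noteq> 0" using pos by auto
    ultimately show ?thesis
      using \<open>snd ?q + g (fst ?q) = u\<^sup>2\<close> by (intro field_differentiable_divide) auto
  qed
  ultimately show ?thesis by (rule holomorphic2_at_compose)
qed

text \<open>Two square charts share one coordinate map, so their transition is the identity. The
  other nontrivial transitions involve the identity chart, which lives over \<open>U\<close>, where
  \<open>g\<close> is holomorphic.\<close>

lemma transition:
  assumes c: "(V, \<phi>) \<in> \<A>" and d: "(W, \<psi>) \<in> \<A>"
  shows "(\<psi> \<circ> inv_into V \<phi>) holomorphic_C2_on (\<phi> ` (V \<inter> W))"
proof -
  have op: "open (\<phi> ` (V \<inter> W))"
    by (intro atlas_image_open[OF c] open_Int atlas_open[OF c] atlas_open[OF d]) auto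
  have inv: "inv_into V \<phi> (\<phi> p) = p" if "p \<in> V" for p
    using atlas_inj[OF c] that by simp
  have 1: "holomorphic2_at (fst \<circ> (\<psi> \<circ> inv_into V \<phi>)) q" if q: "q \<in> \<phi> ` (V \<inter> W)" for q
  proof (rule holomorphic2_at_transform[OF holomorphic2_at_fst op q])
    show "fst q = (fst \<circ> (\<psi> \<circ> inv_into V \<phi>)) q" if "q \<in> \<phi> ` (V \<inter> W)" for q
      using that inv atlas_fst[OF c] atlas_fst[OF d] by auto
  qed
  have 2: "holomorphic2_at (snd \<circ> (\<psi> \<circ> inv_into V \<phi>)) (\<phi> p)" if p: "p \<in> V" "p \<in> W" for p
  proof -
    have im: "\<phi> p \<in> \<phi> ` (V \<inter> W)" using p by auto
    note tr = holomorphic2_at_transform[OF _ op im, of _ "snd \<circ> (\<psi> \<circ> inv_into V \<phi>)"]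
    show ?thesis
    proof (cases "\<phi> = \<psi>")
      case True
      show ?thesis by (rule tr[of snd]) (use inv True in auto)
    next
      case False
      show ?thesis
        using c
      proof (cases rule: atlas_cases)
        case 1
        then have "\<psi> = square_chart g" using d False by (auto elim: atlas_cases)
        moreover have "fst p \<in> U" using 1 p by auto
        ultimately show ?thesis
          using holomorphic2_at_square[of p] inv 1 by (intro tr[of "\<lambda>p. snd (square_chart g p)"]) auto
      next
        case (2 k)
        then have W: "W = U \<times> ball 0 1" "\<psi> = id" using d False by (auto elim: atlas_cases)
        show ?thesis
        proof (rule tr)
          show "holomorphic2_at (\<lambda>q. csqrt (k\<^sup>2 * (snd q + g (fst q))) / k) (\<phi> p)"
            unfolding 2 using p W 2 by (intro holomorphic2_at_square_root) auto
          show "csqrt (k\<^sup>2 * (snd q + g (fst q))) / k = (snd \<circ> (\<psi> \<circ> inv_into V \<phi>)) q"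
            if q: "q \<in> \<phi> ` (V \<inter> W)" for q
          proof -
            obtain p' where p': "p' \<in> V" "q = \<phi> p'" using q by blast
            then have "p' = (fst q, csqrt (k\<^sup>2 * (snd q + g (fst q))) / k)"
              using 2 by (intro square_chart_root) auto
            then show ?thesis using p' inv[OF p'(1)] W by (metis comp_apply id_apply snd_conv)
          qed
        qed
      qed
    qed
  qed
  show ?thesis
    unfolding holomorphic_C2_on_def holomorphic2_on_open[OF op] using 1 2 by auto
qed

lemma atlas_compatible: "c \<in> \<A> \<Longrightarrow> d \<in> \<A> \<Longrightarrow> compatible_charts (holomorphic_C2_on) c d"
  using transition[of "fst c" "snd c" "fst d" "snd d"] transition[of "fst d" "snd d" "fst c" "snd c"]
  by (simp add: compatible_charts_def case_prod_unfold Int_commute)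

lemma complex_surface: "complex_surface X \<A>"
  unfolding complex_surface_def complex_manifold_def
  using Hausdorff_second_countable_top_of_set[of S] atlas_is_chart atlas_cover atlas_compatible
  by (simp add: split_paired_all)

text \<open>In each chart of the atlas the projection is the first coordinate.\<close>

lemma submersion: "holomorphic_submersion X \<A> fst"
  unfolding holomorphic_submersion_def
proof (intro ballI)
  fix c assume "c \<in> \<A>"
  then obtain V \<phi> where c_eq: "c = (V, \<phi>)" and c: "(V, \<phi>) \<in> \<A>" by (cases c) auto
  have "\<exists>A B. ((fst \<circ> inv_into V \<phi>) has_derivative (\<lambda>(h, k). A * h + B * k)) (at p) \<and>
      surj (\<lambda>(h, k). A * h + B * k)" if pq: "p \<in> \<phi> ` V" for p
  proof -
  have fst: "fst y = (fst \<circ> inv_into V \<phi>) y" if "y \<in> \<phi> ` V" for y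
    using that atlas_inj[OF c] atlas_fst[OF c] by auto
  have "(\<lambda>(h, k). 1 * h + 0 * k) = (fst :: complex \<times> complex \<Rightarrow> complex)"
    by (simp add: fun_eq_iff)
  then have "(fst has_derivative (\<lambda>(h, k). 1 * h + 0 * k)) (at p)"
    by (simp add: bounded_linear_fst bounded_linear_imp_has_derivative)
  then have "((fst \<circ> inv_into V \<phi>) has_derivative (\<lambda>(h, k). 1 * h + 0 * k)) (at p)"
    by (rule has_derivative_transform_within_open[OF _ atlas_image_open[OF c atlas_open[OF c] order_refl] pq fst])
  moreover have "surj (\<lambda>(h :: complex, k :: complex). 1 * h + 0 * k)"
    by (auto intro!: surjI[of _ "\<lambda>h. (h, 0)"])
  ultimately show ?thesis by (intro exI conjI)
  qed
  then show "case c of (V, \<phi>) \<Rightarrow> \<forall>p\<in>\<phi> ` V. \<exists>A B.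
      ((fst \<circ> inv_into V \<phi>) has_derivative (\<lambda>(h, k). A * h + B * k)) (at p) \<and>
      surj (\<lambda>(h, k). A * h + B * k)"
    unfolding c_eq prod.case by (rule ballI)
qed

section \<open>The fibers and their topology\<close>

definition "fib z = (if z \<in> U then ball 0 1 else ball 0 1 - {0 :: complex})"

lemma fiber_eq: "z \<in> ball 0 1 \<Longrightarrow> fiber X fst z = {z} \<times> fib z"
  by (auto simp: fiber_def twisted_bidisk_def fib_def)

lemma fiber_space_eq:
  assumes "z \<in> ball 0 1"
  shows "fiber_space X fst z = top_of_set ({z} \<times> fib z)"
proof -
  have "S \<inter> {z} \<times> fib z = {z} \<times> fib z"
    using assms by (auto simp: twisted_bidisk_def fib_def)
  then show ?thesis by (simp add: fiber_eq[OF assms] subtopology_subtopology)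
qed

lemma fst_image: "fst ` topspace X = ball 0 1"
proof -
  have "z \<in> fst ` S" if "z \<in> ball 0 1" for z
    \<comment> \<open>The second coordinate \<open>1 / 2\<close> is nonzero, so the point lies in
      \<open>S\<close> over every \<open>z\<close>.\<close>
    using that by (intro image_eqI[of _ _ "(z, 1 / 2)"]) (auto simp: twisted_bidisk_def)
  then show ?thesis by (auto simp: twisted_bidisk_def)
qed

lemma fib: "open (fib z)" "connected (fib z)"
  by (auto simp: fib_def open_Diff intro!: connected_open_delete)

text \<open>Factor the chart through one of the atlas. On a vertical line
  \<open>square_chart\<close> is the polynomial \<open>u\<^sup>2 - g z\<close> in \<open>u\<close>,
  with \<open>g z\<close> a constant, so the irregularity of \<open>g\<close> in the base is
  invisible on fibers.\<close>

lemma vertical_coordinate_holomorphic: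
  assumes m: "(V, \<phi>) \<in> maximal_atlas (holomorphic_C2_on) X \<A>" and z: "z \<in> ball 0 1"
  shows "(\<lambda>u. snd (\<phi> (z, u))) holomorphic_on {u. (z, u) \<in> V}"
proof -
  have V: "openin X V" and comp: "\<And>d. d \<in> \<A> \<Longrightarrow> compatible_charts (holomorphic_C2_on) (V, \<phi>) d"
    using m by (auto simp: maximal_atlas_def is_chart_def)
  have oV: "open V" "V \<subseteq> S" using V open_S by (auto simp: openin_open_eq openin_imp_subset)
  have "(\<lambda>u. snd (\<phi> (z, u))) field_differentiable at u" if u: "(z, u) \<in> V" for u
  proof -
    obtain W \<psi> where d: "(W, \<psi>) \<in> \<A>" "(z, u) \<in> W"
      using u oV(2) unfolding atlas_cover[symmetric] by fastforce
    have hol: "(\<phi> \<circ> inv_into W \<psi>) holomorphic_C2_on (\<psi> ` (V \<inter> W))"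
      using comp[OF d(1)] by (simp add: compatible_charts_def)
    have op: "open (\<psi> ` (V \<inter> W))"
      by (intro atlas_image_open[OF d(1)] open_Int oV(1) atlas_open[OF d(1)]) auto
    have "holomorphic2_at (snd \<circ> (\<phi> \<circ> inv_into W \<psi>)) (\<psi> (z, u))"
      using hol u d(2) unfolding holomorphic_C2_on_def holomorphic2_on_open[OF op] by auto
    then have "holomorphic2_at (snd \<circ> (\<phi> \<circ> inv_into W \<psi>)) (z, snd (\<psi> (z, u)))"
      using atlas_fst[OF d(1), of "(z, u)"] by (metis fst_conv prod.collapse)
    moreover have "(\<lambda>u. snd (\<psi> (z, u))) field_differentiable at u"
      using d(1)
    proof (cases rule: atlas_cases)
      case 2
      then have "(\<lambda>u. snd (\<psi> (z, u))) = (\<lambda>u. u\<^sup>2 - g z)" by (auto simp: square_chart_def)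
      moreover have "((\<lambda>u. u\<^sup>2 - g z) has_field_derivative 2 * u) (at u)"
        by (auto intro!: derivative_eq_intros)
      ultimately show ?thesis by (auto simp: field_differentiable_def)
    qed (simp add: field_differentiable_ident)
    ultimately have "(\<lambda>u. (snd \<circ> (\<phi> \<circ> inv_into W \<psi>)) (z, snd (\<psi> (z, u)))) field_differentiable at u"
      using holomorphic2_at_curve[of "snd \<circ> (\<phi> \<circ> inv_into W \<psi>)" "\<lambda>_. z" u "\<lambda>u. snd (\<psi> (z, u))"]
        field_differentiable_const by blast
    then obtain f' where f': "((\<lambda>u. (snd \<circ> (\<phi> \<circ> inv_into W \<psi>)) (z, snd (\<psi> (z, u)))) has_field_derivative f') (at u)"
      unfolding field_differentiable_def by (elim exE)
    have "open (Pair z -` (V \<inter> W))"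
      using oV(1) atlas_open[OF d(1)] by (intro open_vimage open_Int continuous_intros)
    moreover have "u \<in> Pair z -` (V \<inter> W)" using u d by auto
    moreover have "(snd \<circ> (\<phi> \<circ> inv_into W \<psi>)) (z, snd (\<psi> (z, y))) = snd (\<phi> (z, y))"
      if "y \<in> Pair z -` (V \<inter> W)" for y
    proof -
      have "(z, snd (\<psi> (z, y))) = \<psi> (z, y)"
        using atlas_fst[OF d(1), of "(z, y)"] by (metis fst_conv prod.collapse)
      then show ?thesis using that atlas_inj[OF d(1)] by simp
    qed
    ultimately have "((\<lambda>u. snd (\<phi> (z, u))) has_field_derivative f') (at u)"
      by (rule has_field_derivative_transform_within_open[OF f'])
    then show ?thesis unfolding field_differentiable_def by (rule exI)
  qed
  then show ?thesis
    by (auto simp: holomorphic_on_def intro: field_differentiable_at_within)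
qed

lemma fiber_riemann_surface:
  assumes z: "z \<in> ball 0 1"
  shows "riemann_surface (fiber_space X fst z) (fiber_atlas X \<A> fst z)"
    and "biholomorphic_to_domain (fiber_space X fst z) (fiber_atlas X \<A> fst z) (fib z)"
proof -
  let ?B = "fiber_atlas X \<A> fst z"
  have B: "\<exists>V \<phi>. V' = V \<inter> {z} \<times> fib z \<and> \<psi> = snd \<circ> \<phi> \<and>
      (V, \<phi>) \<in> maximal_atlas (holomorphic_C2_on) X \<A> \<and> (\<forall>x\<in>V. fst (\<phi> x) = fst x)"
    if "(V', \<psi>) \<in> ?B" for V' \<psi>
    using that by (auto simp: fiber_atlas_def fiber_eq[OF z])
  have sub: "{z} \<times> fib z \<subseteq> S" using z by (auto simp: fib_def twisted_bidisk_def)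
  have 1: "openin (top_of_set ({z} \<times> fib z)) V'" if m: "(V', \<psi>) \<in> ?B" for V' \<psi>
  proof -
    obtain V \<phi> where V: "V' = V \<inter> {z} \<times> fib z" "(V, \<phi>) \<in> maximal_atlas (holomorphic_C2_on) X \<A>"
      using B[OF m] by blast
    then have "openin X V" by (auto simp: maximal_atlas_def is_chart_def)
    then have "open V" using open_S by (simp add: openin_open_eq)
    then show ?thesis using V(1) by (auto simp: openin_open)
  qed
  have 2: "(\<lambda>u. \<psi> (z, u)) holomorphic_on {u. (z, u) \<in> V'}" if m: "(V', \<psi>) \<in> ?B" for V' \<psi>
  proof -
    obtain V \<phi> where V: "V' = V \<inter> {z} \<times> fib z" "\<psi> = snd \<circ> \<phi>" "(V, \<phi>) \<in> maximal_atlas (holomorphic_C2_on) X \<A>"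
      using B[OF m] by blast
    show ?thesis
      using holomorphic_on_subset[OF vertical_coordinate_holomorphic[OF V(3) z], of "{u. (z, u) \<in> V'}"] V
      by auto
  qed
  have 3: "inj_on \<psi> V'" if m: "(V', \<psi>) \<in> ?B" for V' \<psi>
  proof -
    obtain V \<phi> where V: "V' = V \<inter> {z} \<times> fib z" "\<psi> = snd \<circ> \<phi>"
        "(V, \<phi>) \<in> maximal_atlas (holomorphic_C2_on) X \<A>" "\<forall>x\<in>V. fst (\<phi> x) = fst x"
      using B[OF m] by blast
    have "homeomorphic_map (subtopology X V) (top_of_set (\<phi> ` V)) \<phi>" and VX: "openin X V"
      using V(3) by (auto simp: maximal_atlas_def is_chart_def)
    then have "inj_on \<phi> (topspace (subtopology X V))"
      by (simp only: homeomorphic_eq_everything_map)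
    moreover have "topspace (subtopology X V) = V" using openin_subset[OF VX] by auto
    ultimately have inj: "inj_on \<phi> V" by simp
    show ?thesis
    proof (rule inj_onI)
      \<comment> \<open>Both points lie over \<open>z\<close>, and the first coordinate of
        \<open>\<phi>\<close> is the projection; equal second coordinates therefore give equal chart
        values.\<close>
      fix x y assume xy: "x \<in> V'" "y \<in> V'" "\<psi> x = \<psi> y"
      then have "x \<in> V" "y \<in> V" "fst x = z" "fst y = z" "snd (\<phi> x) = snd (\<phi> y)"
        using V(1,2) by auto
      moreover from this have "fst (\<phi> x) = fst (\<phi> y)" using V(4) by simp
      ultimately have "\<phi> x = \<phi> y" by (intro prod_eqI)
      then show "x = y" using \<open>x \<in> V\<close> \<open>y \<in> V\<close> by (rule inj_onD[OF inj])
    qed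
  qed
  have 4: "(\<Union>c\<in>?B. fst c) = {z} \<times> fib z"
  proof (intro equalityI subsetI)
    fix x assume x: "x \<in> {z} \<times> fib z"
    then have "x \<in> S" using sub by blast
    then have "x \<in> (\<Union>c\<in>\<A>. fst c)" by (simp only: atlas_cover)
    then obtain W \<psi> where W: "(W, \<psi>) \<in> \<A>" "x \<in> W" by auto
    have "(W, \<psi>) \<in> maximal_atlas (holomorphic_C2_on) X \<A>"
      using W atlas_is_chart atlas_compatible by (simp add: maximal_atlas_def)
    then have "(W \<inter> fiber X fst z, snd \<circ> \<psi>) \<in> ?B"
      using atlas_fst[OF W(1)] unfolding fiber_atlas_def
      by (intro CollectI exI[of _ W] exI[of _ \<psi>]) simp
    then show "x \<in> (\<Union>c\<in>?B. fst c)"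
      by (rule UN_I) (use x W(2) in \<open>simp add: fiber_eq[OF z]\<close>)
  next
    fix x assume "x \<in> (\<Union>c\<in>?B. fst c)"
    then show "x \<in> {z} \<times> fib z" using fiber_eq[OF z] by (auto simp: fiber_atlas_def)
  qed
  show "riemann_surface (fiber_space X fst z) ?B" "biholomorphic_to_domain (fiber_space X fst z) ?B (fib z)"
    unfolding fiber_space_eq[OF z]
    by (rule vertical_domain[OF fib 1 2 3 4]; assumption)+
qed

text \<open>The circle of radius \<open>1 / 2\<close> in the fiber, parametrized by the unit circle,
  with the radial retraction onto it.\<close>

lemma circle_retract:
  fixes s :: complex
  assumes z: "z \<in> ball 0 1" "z \<notin> U"
  shows "continuous_map (top_of_set (sphere 0 1)) (fiber_space X fst z) (\<lambda>s. (z, s / 2))"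
    and "continuous_map (fiber_space X fst z) (top_of_set (sphere (0::complex) 1)) (\<lambda>p. snd p / norm (snd p))"
    and "s \<in> sphere 0 1 \<Longrightarrow> (\<lambda>p. snd p / norm (snd p)) (z, s / 2) = s"
proof -
  have fib: "fib z = ball 0 1 - {0}" using z by (simp add: fib_def)
  show "continuous_map (top_of_set (sphere 0 1)) (fiber_space X fst z) (\<lambda>s. (z, s / 2))"
    unfolding fiber_space_eq[OF z(1)] fib by (auto intro!: continuous_intros)
  show "continuous_map (fiber_space X fst z) (top_of_set (sphere (0::complex) 1)) (\<lambda>p. snd p / norm (snd p))"
    unfolding fiber_space_eq[OF z(1)] fib by (auto simp: norm_divide intro!: continuous_intros split: if_splits)
  show "s \<in> sphere 0 1 \<Longrightarrow> (\<lambda>p. snd p / norm (snd p)) (z, s / 2) = s"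
    by (simp add: norm_divide)
qed

text \<open>A disk has trivial first homology, whereas the circle is a retract of this
  fiber.\<close>

lemma not_disk:
  assumes z: "z \<in> ball 0 1" "z \<notin> U"
  shows "\<not> is_disk (fiber_space X fst z) (fiber_atlas X \<A> fst z)"
proof
  assume "is_disk (fiber_space X fst z) (fiber_atlas X \<A> fst z)"
  then obtain h where "homeomorphic_map (fiber_space X fst z) (top_of_set (ball (0::complex) 1)) h"
    by (auto simp: is_disk_def biholomorphic_to_domain_def)
  then obtain k where k: "homeomorphic_maps (fiber_space X fst z) (top_of_set (ball (0::complex) 1)) h k"
    using homeomorphic_map_maps by blast
  have "contractible_space (top_of_set (ball (0::complex) 1))"
    by (simp add: convex_imp_contractible contractible_space_top_of_set)
  then have "trivial_group (homology_group 1 (top_of_set (ball (0::complex) 1)))"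
    using trivial_reduced_homology_group_contractible_space[of "top_of_set (ball (0::complex) 1)" 1]
    by (simp add: un_reduced_homology_group)
  then have "trivial_group (homology_group 1 (fiber_space X fst z))"
    using k by (intro trivial_homology_group_retract[of _ _ h k]) (auto simp: homeomorphic_maps_def)
  then have "trivial_group (homology_group 1 (top_of_set (sphere (0::complex) 1)))"
    by (intro trivial_homology_group_retract[OF circle_retract(1,2)[OF z]] circle_retract(3)[OF z]) simp
  then show False by (simp add: nontrivial_homology_group_circle)
qed

lemma disk: "z \<in> U \<Longrightarrow> is_disk (fiber_space X fst z) (fiber_atlas X \<A> fst z)"
  using fiber_riemann_surface[of z] U by (auto simp: is_disk_def fib_def)

lemma punctured_disk:
  "z \<in> ball 0 1 \<Longrightarrow> z \<notin> U \<Longrightarrow> is_punctured_disk (fiber_space X fst z) (fiber_atlas X \<A> fst z)"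
  using fiber_riemann_surface[of z] by (auto simp: is_punctured_disk_def fib_def)

lemma disk_with_possible_punctures:
  assumes z: "z \<in> ball 0 1"
  shows "is_disk_with_possible_punctures (fiber_space X fst z) (fiber_atlas X \<A> fst z)"
proof -
  have "closedin (top_of_set (ball 0 1)) {0::complex}"
    by (auto simp: closedin_closed intro!: exI[of _ "{0}"])
  moreover have "discrete {0::complex}" "discrete ({}::complex set)"
    by (auto simp: discrete_def isolated_in_def intro!: exI[of _ UNIV])
  moreover have "fib z = ball 0 1 - (if z \<in> U then {} else {0})" by (simp add: fib_def)
  ultimately show ?thesis
    unfolding is_disk_with_possible_punctures_def
    using fiber_riemann_surface[OF z] by (intro conjI exI[of _ "if z \<in> U then {} else {0}"]) auto
qed

end

section \<open>Foliated maps into the twisted bidisk\<close>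

lemma open_hartogs_figure: "open (hartogs_figure \<epsilon>)"
  unfolding hartogs_figure_def annulus_def by (intro open_Un open_Times open_Diff closed_closure open_ball)

lemma field_differentiable_transform_open:
  assumes "f field_differentiable at x" "open T" "x \<in> T" "\<And>y. y \<in> T \<Longrightarrow> f y = h y"
  shows "h field_differentiable at x"
proof -
  obtain D where "(f has_field_derivative D) (at x)"
    using assms(1) unfolding field_differentiable_def by (elim exE)
  from has_field_derivative_transform_within_open[OF this assms(2-4)] show ?thesis
    unfolding field_differentiable_def by (rule exI)
qed

lemma holomorphic2_at_slices:
  assumes F: "holomorphic2_at F (z, w)" and H: "open H" "(z, w) \<in> H"
    and eq: "\<And>z w. (z, w) \<in> H \<Longrightarrow> F (z, w) = k z w"
  shows "(\<lambda>z. k z w) field_differentiable at z" and "k z field_differentiable at w"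
proof -
  have const: "(\<lambda>t. y) field_differentiable at x" for x y :: complex
    by (rule field_differentiable_const)
  have id: "(\<lambda>t. t) field_differentiable at x" for x :: complex
    by (rule field_differentiable_ident)
  have "open ((\<lambda>z. (z, w)) -` H)" "open (Pair z -` H)"
    using H by (auto intro!: open_vimage continuous_intros)
  moreover have "(\<lambda>z. F (z, w)) field_differentiable at z"
    by (rule holomorphic2_at_curve[where f = F and a = "\<lambda>t. t" and b = "\<lambda>t. w", OF F id const])
  moreover have "(\<lambda>w. F (z, w)) field_differentiable at w"
    by (rule holomorphic2_at_curve[where f = F and a = "\<lambda>t. z" and b = "\<lambda>t. t", OF F const id])
  ultimately show "(\<lambda>z. k z w) field_differentiable at z" "k z field_differentiable at w"
    using H eq by (auto intro: field_differentiable_transform_open)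
qed

context twisted_bidisk_surface
begin

text \<open>The function \<open>u\<^sup>2 - g \<circ> \<zeta>\<close> is holomorphic at every point
  of the figure: over \<open>U\<close> by the standard chart and holomorphy of \<open>g\<close>,
  elsewhere because it is the second coordinate in a square chart.\<close>

lemma foliated_map_data:
  assumes eps: "0 < \<epsilon>" "\<epsilon> < 1" and f: "foliated_map X \<A> fst \<epsilon> f" and a: "a \<in> U" and 0: "0 \<notin> U"
    and f0: "f ` ({0} \<times> ball 0 1) \<subseteq> fiber X fst a" and f1: "f ` ({1} \<times> sphere 0 1) \<subseteq> fiber X fst 0"
  obtains \<zeta> u where "foliated_hartogs_map \<epsilon> \<zeta> g u U" "\<zeta> 1 = 0"
    "\<And>z w. (z, w) \<in> hartogs_figure \<epsilon> \<Longrightarrow> f (z, w) = (\<zeta> z, u z w) \<and> norm (u z w) < 1"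
proof -
  let ?H = "hartogs_figure \<epsilon>"
  obtain \<zeta> where \<zeta>: "\<zeta> holomorphic_on ball 0 (1 + \<epsilon>)" and fst: "\<And>z w. (z, w) \<in> ?H \<Longrightarrow> fst (f (z, w)) = \<zeta> z"
    using f unfolding foliated_map_def by blast
  have cont: "continuous_map (top_of_set ?H) X f"
    and hol: "\<And>V \<phi>. (V, \<phi>) \<in> \<A> \<Longrightarrow> (\<phi> \<circ> f) holomorphic_C2_on (?H \<inter> f -` V)"
    using f unfolding foliated_map_def holomorphic_to_surface_def by auto
  have fc: "continuous_on ?H f" and fS: "\<And>p. p \<in> ?H \<Longrightarrow> f p \<in> S"
    using cont by (auto simp: continuous_map_in_subtopology)
  define u where "u z w = snd (f (z, w))" for z w
  have in01: "(0, 0) \<in> ?H" "(1, 1) \<in> ?H"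
    using eps by (auto simp: hartogs_figure_def annulus_eq)
  have chart: "holomorphic2_at (snd \<circ> (\<phi> \<circ> f)) p" if c: "(V, \<phi>) \<in> \<A>" and p: "p \<in> ?H" "f p \<in> V" for V \<phi> p
  proof -
    have op: "open (?H \<inter> f -` V)"
      by (rule continuous_open_preimage[OF fc open_hartogs_figure atlas_open[OF c]])
    show ?thesis
      using hol[OF c] p unfolding holomorphic_C2_on_def holomorphic2_on_open[OF op] by auto
  qed
  have ball: "fst (f p) \<in> ball 0 1" "snd (f p) \<in> ball 0 1" if "p \<in> ?H" for p
    using fS[OF that] by (auto simp: twisted_bidisk_def)
  have over_U: "holomorphic2_at (\<lambda>p. snd (f p)) p" if p: "p \<in> ?H" "fst (f p) \<in> U" for p
  proof -
    have "f p \<in> U \<times> ball 0 1" using p ball[OF p(1)] by (cases "f p") auto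
    moreover have "(U \<times> ball 0 1, id) \<in> \<A>" by (simp add: twisted_atlas_def)
    ultimately have "holomorphic2_at (snd \<circ> (id \<circ> f)) p" using p by (intro chart)
    then show ?thesis by (simp add: o_def)
  qed
  have fst_hol: "holomorphic2_at (\<lambda>p. \<zeta> (fst p)) (z, w)" if p: "(z, w) \<in> ?H" for z w
  proof (rule holomorphic2_at_compose[OF holomorphic2_at_fst])
    have "z \<in> ball 0 (1 + \<epsilon>)" using p eps by (auto simp: hartogs_figure_def)
    then show "\<zeta> field_differentiable at (fst (z, w))"
      using \<zeta> by (simp add: holomorphic_on_imp_differentiable_at)
  qed
  have square: "holomorphic2_at (\<lambda>p. (snd (f p))\<^sup>2 - g (\<zeta> (fst p))) (z, w)" if p: "(z, w) \<in> ?H" for z w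
  proof (cases "\<zeta> z \<in> U")
    case True
    have "(\<lambda>y::complex. y\<^sup>2) field_differentiable at y" for y
      by (auto simp: field_differentiable_def intro!: exI derivative_eq_intros)
    moreover have "holomorphic2_at (\<lambda>p. snd (f p)) (z, w)"
      using True fst[OF p] by (intro over_U p) simp
    ultimately have "holomorphic2_at (\<lambda>p. (snd (f p))\<^sup>2) (z, w)"
      by (intro holomorphic2_at_compose[where h = "\<lambda>y. y\<^sup>2"])
    moreover have "holomorphic2_at (\<lambda>p. g (\<zeta> (fst p))) (z, w)"
      by (rule holomorphic2_at_compose[OF fst_hol[OF p]]) (use True g_diff in simp)
    ultimately show ?thesis by (rule holomorphic2_at_diff)
  next
    case False
    let ?c = "cnj (snd (f (z, w)))"
    have "snd (f (z, w)) \<noteq> 0"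
      using fS[OF p] fst[OF p] False by (auto simp: twisted_bidisk_def)
    then have "0 < Re (?c * snd (f (z, w)))" by (simp add: complex_neq_0 flip: power2_eq_square)
    then have "f (z, w) \<in> half_bidisk ?c"
      using ball[OF p] by (cases "f (z, w)") (auto simp: half_bidisk_def)
    moreover have "(half_bidisk ?c, square_chart g) \<in> \<A>" by (simp add: twisted_atlas_def)
    ultimately have "holomorphic2_at (snd \<circ> (square_chart g \<circ> f)) (z, w)" using p by (intro chart)
    then show ?thesis
    proof (rule holomorphic2_at_transform[OF _ open_hartogs_figure p])
      show "(snd \<circ> (square_chart g \<circ> f)) q = (snd (f q))\<^sup>2 - g (\<zeta> (fst q))" if "q \<in> ?H" for q
        using that fst[of "fst q" "snd q"] by (simp add: square_chart_def case_prod_unfold)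
    qed
  qed
  have "foliated_hartogs_map \<epsilon> \<zeta> g u U"
  proof
    show "continuous_on ?H (\<lambda>(z, w). u z w)"
      using continuous_on_snd[OF fc] by (simp add: u_def case_prod_unfold)
    show "(\<lambda>z. (u z w)\<^sup>2 - g (\<zeta> z)) field_differentiable at z"
      "(\<lambda>w. (u z w)\<^sup>2 - g (\<zeta> z)) field_differentiable at w" if p: "(z, w) \<in> ?H" for z w
      by (rule holomorphic2_at_slices[OF square[OF p] open_hartogs_figure p, of "\<lambda>z w. (u z w)\<^sup>2 - g (\<zeta> z)"];
          simp add: u_def)+
    show "(\<lambda>z. u z w) field_differentiable at z" "u z field_differentiable at w"
      if p: "(z, w) \<in> ?H" and zU: "\<zeta> z \<in> U" for z w
    proof -
      have "holomorphic2_at (\<lambda>p. snd (f p)) (z, w)"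
        using zU fst[OF p] by (intro over_U p) simp
      from holomorphic2_at_slices[OF this open_hartogs_figure p, of u]
      show "(\<lambda>z. u z w) field_differentiable at z" "u z field_differentiable at w"
        by (simp_all add: u_def)
    qed
    show "u z w \<noteq> 0" if "(z, w) \<in> ?H" "\<zeta> z \<notin> U" for z w
      using fS[OF that(1)] fst[OF that(1)] that(2) by (auto simp: u_def twisted_bidisk_def)
    show "\<zeta> 0 \<in> U"
    proof -
      have "f (0, 0) \<in> fiber X fst a" using f0 by auto
      then show ?thesis using fst[OF in01(1)] a by (simp add: fiber_def)
    qed
    show "\<zeta> 1 \<notin> U"
    proof -
      have "f (1, 1) \<in> fiber X fst 0" using f1 by auto
      then show ?thesis using fst[OF in01(2)] 0 by (simp add: fiber_def)
    qed
  qed (use eps \<zeta> U g in auto)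
  moreover have "\<zeta> 1 = 0"
  proof -
    have "f (1, 1) \<in> fiber X fst 0" using f1 by auto
    then show ?thesis using fst[OF in01(2)] by (simp add: fiber_def)
  qed
  moreover have "f (z, w) = (\<zeta> z, u z w) \<and> norm (u z w) < 1" if "(z, w) \<in> ?H" for z w
    using fst[OF that] ball[OF that] by (simp add: u_def prod_eq_iff)
  ultimately show ?thesis by (rule that)
qed

end

text \<open>The zero-free extension of \<open>u 1\<close> stays below modulus 1 by the maximum
  principle, so it maps the closed disk into the punctured disk and fills the loop.\<close>

lemma (in foliated_hartogs_map) null_homologous_extension:
  assumes nz: "\<And>w. w \<in> cball 0 1 \<Longrightarrow> G 1 w \<noteq> 0"
    and bound: "\<And>w. w \<in> sphere 0 1 \<Longrightarrow> norm (u 1 w) < 1"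
    and \<gamma>: "\<And>w. w \<in> sphere 0 1 \<Longrightarrow> \<gamma> w = (0 :: complex, u 1 w)"
  shows "singular_relboundary 1 (top_of_set ({0} \<times> (ball 0 1 - {0}))) {} (loop_cycle \<gamma>)"
proof -
  have "1 \<in> D" using eps by simp
  then obtain v where v: "continuous_on (cball 0 1) v" "v holomorphic_on ball 0 1"
      "\<And>w. w \<in> cball 0 1 \<Longrightarrow> v w \<noteq> 0" "\<And>w. w \<in> sphere 0 1 \<Longrightarrow> v w = u 1 w"
    using zero_free_extension[OF _ nz] eps by auto
  have "continuous_on (sphere 0 1) (\<lambda>w. norm (v w))"
    by (intro continuous_intros continuous_on_subset[OF v(1)]) auto
  then obtain w1 where w1: "w1 \<in> sphere 0 1" "\<And>w. w \<in> sphere 0 1 \<Longrightarrow> norm (v w) \<le> norm (v w1)"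
    using continuous_attains_sup[of "sphere (0::complex) 1" "\<lambda>w. norm (v w)"] by auto
  have lt1: "norm (v w1) < 1" using bound[OF w1(1)] v(4)[OF w1(1)] by simp
  have "norm (v w) < 1" if w: "w \<in> cball 0 1" for w
  proof -
    have "norm (v w) \<le> norm (v w1)"
    proof (rule maximum_modulus_frontier[of v "cball 0 1"])
      show "v holomorphic_on interior (cball 0 1)" using v(2) by simp
      show "continuous_on (closure (cball 0 1)) v" using v(1) by simp
      show "norm (v x) \<le> norm (v w1)" if "x \<in> frontier (cball 0 1)" for x
        using that w1(2) by simp
    qed (use w in auto)
    then show ?thesis using lt1 by simp
  qed
  then have "continuous_map (top_of_set (cball 0 1)) (top_of_set ({0} \<times> (ball 0 1 - {0}))) (\<lambda>w. (0 :: complex, v w))"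
    using v(1,3) by (auto simp: continuous_map_in_subtopology intro!: continuous_intros)
  then show ?thesis
    by (rule loop_cycle_null_homologous) (simp add: \<gamma> v(4))
qed

text \<open>The affine map takes the disk with centre and radius \<open>1 / 2\<close> to the unit
  disk and sends 0 to the boundary point -1; \<open>closest_point\<close> extends the function
  continuously to the whole plane.\<close>

definition lacunary_on_disk :: "complex \<Rightarrow> complex"
  where "lacunary_on_disk b = lacunary (closest_point (cball 0 1) (2 * b - 1))"

lemma ball_half_iff: "b \<in> ball (1/2) (1/2) \<longleftrightarrow> norm (2 * b - 1) < 1" for b :: complex
proof -
  have "norm (2 * b - 1) = norm (2 * (b - 1/2))" by (simp add: algebra_simps)
  also have "\<dots> = 2 * dist (1/2) b" by (simp only: norm_mult dist_norm norm_minus_commute) simp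
  finally show ?thesis unfolding mem_ball by linarith
qed

lemma lacunary_on_disk_deriv:
  assumes "b \<in> ball (1/2) (1/2)"
  shows "(lacunary_on_disk has_field_derivative 2 * deriv lacunary (2 * b - 1)) (at b)"
proof -
  have "norm (2 * b - 1) < 1" using assms by (simp only: ball_half_iff)
  then have "(lacunary has_field_derivative deriv lacunary (2 * b - 1)) (at (2 * b - 1))"
    using lacunary_deriv_sums(1)[of "2 * b - 1"] by (simp add: field_differentiable_derivI)
  moreover have "((\<lambda>b. 2 * b - 1) has_field_derivative 2) (at b)"
    by (auto intro!: derivative_eq_intros)
  ultimately have "((\<lambda>b. lacunary (2 * b - 1)) has_field_derivative deriv lacunary (2 * b - 1) * 2) (at b)"
    by (rule DERIV_chain2)
  then have "(lacunary_on_disk has_field_derivative deriv lacunary (2 * b - 1) * 2) (at b)"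
  proof (rule has_field_derivative_transform_within_open[OF _ open_ball assms])
    fix y :: complex assume "y \<in> ball (1/2) (1/2)"
    then have "2 * y - 1 \<in> cball 0 1" by (simp only: ball_half_iff) simp
    then show "lacunary (2 * y - 1) = lacunary_on_disk y"
      by (simp add: lacunary_on_disk_def closest_point_self)
  qed
  then show ?thesis by (simp add: mult.commute)
qed

lemma continuous_on_lacunary_on_disk: "continuous_on UNIV lacunary_on_disk"
proof -
  have "continuous_on UNIV (closest_point (cball (0::complex) 1))"
    by (intro continuous_on_closest_point) auto
  then have "continuous_on UNIV (\<lambda>b. closest_point (cball (0::complex) 1) (2 * b - 1))"
    by (rule continuous_on_compose2) (auto intro!: continuous_intros)
  moreover have "closest_point (cball (0::complex) 1) y \<in> cball 0 1" for y
    by (intro closest_point_in_set) auto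
  ultimately show ?thesis
    unfolding lacunary_on_disk_def by (intro continuous_on_compose2[OF continuous_on_lacunary]) auto
qed

theorem mainTheorem1:
  "\<exists>(X :: (complex \<times> complex) topology) (\<A> :: (complex \<times> complex, complex \<times> complex) chart set)
      (\<pi> :: complex \<times> complex \<Rightarrow> complex) (U :: complex set).
    complex_surface X \<A> \<and>
    holomorphic_submersion X \<A> \<pi> \<and> \<pi> ` topspace X = ball 0 1 \<and>
    (\<forall>z\<in>ball 0 1. is_disk_with_possible_punctures (fiber_space X \<pi> z) (fiber_atlas X \<A> \<pi> z)) \<and>
    is_punctured_disk (fiber_space X \<pi> 0) (fiber_atlas X \<A> \<pi> 0) \<and>
    U = {z \<in> ball 0 1. is_disk (fiber_space X \<pi> z) (fiber_atlas X \<A> \<pi> z)} \<and>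
    U \<noteq> {} \<and> open U \<and> 0 \<in> frontier U \<and>
    (\<forall>\<gamma>\<^sub>0 a \<gamma>\<^sub>a.
      circle_around_puncture (fiber_space X \<pi> 0) (fiber_atlas X \<A> \<pi> 0) \<gamma>\<^sub>0 \<longrightarrow>
      a \<in> U \<longrightarrow>
      is_circle_in (fiber_space X \<pi> a) (fiber_atlas X \<A> \<pi> a) \<gamma>\<^sub>a \<longrightarrow>
      \<not> (\<exists>\<epsilon> f. 0 < \<epsilon> \<and> \<epsilon> < 1 \<and> foliated_map X \<A> \<pi> \<epsilon> f \<and>
            f ` ({0} \<times> ball 0 1) \<subseteq> fiber X \<pi> a \<and>
            f ` ({1} \<times> sphere 0 1) \<subseteq> fiber X \<pi> 0 \<and>
            homologous_rel 1 (fiber_space X \<pi> 0) {}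
              (loop_cycle (\<lambda>w. f (1, w))) (loop_cycle \<gamma>\<^sub>0)))"
proof -
  \<comment> \<open>This disk touches the unit circle at 1 from inside and has 0 on its
    boundary.\<close>
  define U :: "complex set" where "U = ball (1/2) (1/2)"
  have U_sub: "U \<subseteq> ball 0 1"
  proof
    fix b assume "b \<in> U"
    then have "norm (b - 1/2) < 1/2" by (simp add: U_def dist_norm norm_minus_commute)
    then have "norm ((b - 1/2) + 1/2) < 1" using norm_triangle_ineq[of "b - 1/2" "1/2"] by simp
    then show "b \<in> ball 0 1" by simp
  qed
  have U0: "0 \<notin> U" by (simp add: U_def)
  have g_hol: "lacunary_on_disk holomorphic_on U"
    unfolding U_def holomorphic_on_def field_differentiable_def
    using lacunary_on_disk_deriv has_field_derivative_at_within by blast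
  interpret twisted_bidisk_surface U lacunary_on_disk
    by unfold_locales (use U_sub continuous_on_lacunary_on_disk g_hol in \<open>auto simp: U_def\<close>)
  have zero: "(0::complex) \<in> ball 0 1" by simp
  have no_map: False
    if \<gamma>\<^sub>0: "circle_around_puncture (fiber_space X fst 0) (fiber_atlas X \<A> fst 0) \<gamma>\<^sub>0" and a: "a \<in> U"
      and eps: "0 < \<epsilon>" "\<epsilon> < 1" and f: "foliated_map X \<A> fst \<epsilon> f"
      and f0: "f ` ({0} \<times> ball 0 1) \<subseteq> fiber X fst a" and f1: "f ` ({1} \<times> sphere 0 1) \<subseteq> fiber X fst 0"
      and hom: "homologous_rel 1 (fiber_space X fst 0) {} (loop_cycle (\<lambda>w. f (1, w))) (loop_cycle \<gamma>\<^sub>0)"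
    for \<gamma>\<^sub>0 a \<epsilon> f
  proof -
    obtain \<zeta> u where H: "foliated_hartogs_map \<epsilon> \<zeta> lacunary_on_disk u U" and \<zeta>1: "\<zeta> 1 = 0"
      and fu: "\<And>z w. (z, w) \<in> hartogs_figure \<epsilon> \<Longrightarrow> f (z, w) = (\<zeta> z, u z w) \<and> norm (u z w) < 1"
      using foliated_map_data[OF eps f a U0 f0 f1] by blast
    interpret foliated_hartogs_map \<epsilon> \<zeta> lacunary_on_disk u U by (rule H)
    show False
      using zero_free_or_bounded_deriv
    proof (elim disjE exE conjE)
      \<comment> \<open>In this case the loop over \<open>z = 1\<close> bounds in the central fiber,
        and with it the homologous circle around the puncture.\<close>
      assume nz: "\<forall>w\<in>cball 0 1. G 1 w \<noteq> 0"
      have in1: "(1, w) \<in> hartogs_figure \<epsilon>" if "w \<in> sphere 0 1" for w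
        using that eps by (intro in_hartogs1) auto
      have "singular_relboundary 1 (top_of_set ({0} \<times> (ball 0 1 - {0}))) {} (loop_cycle (\<lambda>w. f (1, w)))"
        using nz fu[OF in1] \<zeta>1 by (intro null_homologous_extension) auto
      then have "singular_relboundary 1 (fiber_space X fst 0) {} (loop_cycle (\<lambda>w. f (1, w)))"
        using U0 by (simp add: fiber_space_eq fib_def)
      then have "singular_relboundary 1 (fiber_space X fst 0) {} (loop_cycle \<gamma>\<^sub>0)"
        using hom homologous_rel_set_eq homologous_rel_set_eq_relboundary by metis
      then show False
        using circle_around_puncture_not_null[OF circle_retract[OF zero U0] \<gamma>\<^sub>0] by blast
    next
      fix t1 r M :: real
      assume r: "0 < r" and t1: "0 < t1" "t1 \<le> 1" "\<zeta> (of_real t1) \<notin> U"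
        and bd: "\<forall>t. t1 - r < t \<longrightarrow> t < t1 \<longrightarrow> \<zeta> (of_real t) \<in> U \<and>
          norm (deriv lacunary_on_disk (\<zeta> (of_real t)) * deriv \<zeta> (of_real t)) \<le> M"
      \<comment> \<open>The bound by \<open>\<epsilon>\<close> keeps the ball inside
        \<open>D\<close>, even when \<open>t1 = 1\<close>.\<close>
      define r' where "r' = min r \<epsilon>"
      define \<xi> where "\<xi> z = 2 * \<zeta> z - 1" for z
      have sub: "ball (of_real t1) r' \<subseteq> D"
      proof
        fix y assume "y \<in> ball (complex_of_real t1) r'"
        then have "norm (y - of_real t1) < \<epsilon>" by (simp add: r'_def dist_norm norm_minus_commute)
        then have "norm ((y - of_real t1) + of_real t1) < \<epsilon> + 1"
          using t1 norm_triangle_ineq[of "y - of_real t1" "of_real t1"] by simp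
        then show "y \<in> D" by simp
      qed
      show False
      proof (rule lacunary_compose_deriv_unbounded)
        show "\<xi> holomorphic_on ball (of_real t1) r'"
          unfolding \<xi>_def by (intro holomorphic_intros holomorphic_on_subset[OF zeta sub])
        show "0 < r'" using r eps by (simp add: r'_def)
        show "1 \<le> norm (\<xi> (of_real t1))"
          using t1(3) unfolding U_def \<xi>_def ball_half_iff by simp
        fix t assume t: "t1 - r' < t" "t < t1"
        then have tU: "\<zeta> (of_real t) \<in> U" and tM: "norm (deriv lacunary_on_disk (\<zeta> (of_real t)) * deriv \<zeta> (of_real t)) \<le> M"
          using bd by (auto simp: r'_def)
        show "norm (\<xi> (of_real t)) < 1"
          using tU unfolding U_def \<xi>_def ball_half_iff .
        have "of_real t \<in> ball (complex_of_real t1) r'"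
          using t by (simp add: dist_of_real dist_real_def)
        then have "(\<zeta> has_field_derivative deriv \<zeta> (of_real t)) (at (of_real t))"
          using sub by (intro holomorphic_derivI[OF zeta open_ball]) blast
        then have "(\<xi> has_field_derivative 2 * deriv \<zeta> (of_real t)) (at (of_real t))"
          unfolding \<xi>_def by (auto intro!: derivative_eq_intros)
        then have "deriv \<xi> (of_real t) = 2 * deriv \<zeta> (of_real t)" by (rule DERIV_imp_deriv)
        \<comment> \<open>The factor 2 moves from the derivative of \<open>lacunary_on_disk\<close>
          to that of \<open>\<xi>\<close>, so the product, and hence the bound \<open>M\<close>, is
          unchanged.\<close>
        moreover have "deriv lacunary_on_disk (\<zeta> (of_real t)) = 2 * deriv lacunary (\<xi> (of_real t))"
          using lacunary_on_disk_deriv[of "\<zeta> (of_real t)"] tU by (simp add: U_def \<xi>_def DERIV_imp_deriv)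
        ultimately show "norm (deriv lacunary (\<xi> (of_real t)) * deriv \<xi> (of_real t)) \<le> M"
          using tM by (simp add: mult_ac)
      qed
    qed
  qed
  show ?thesis
  proof (intro exI[of _ X] exI[of _ \<A>] exI[of _ fst] exI[of _ U] conjI allI impI)
    show "complex_surface X \<A>" by (rule complex_surface)
    show "holomorphic_submersion X \<A> fst" by (rule submersion)
    show "fst ` topspace X = ball 0 1" by (rule fst_image)
    show "\<forall>z\<in>ball 0 1. is_disk_with_possible_punctures (fiber_space X fst z) (fiber_atlas X \<A> fst z)"
      using disk_with_possible_punctures by (rule ballI)
    show "is_punctured_disk (fiber_space X fst 0) (fiber_atlas X \<A> fst 0)"
      using zero U0 by (rule punctured_disk)
    show "U = {z \<in> ball 0 1. is_disk (fiber_space X fst z) (fiber_atlas X \<A> fst z)}"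
    proof (intro Set.set_eqI iffI)
      fix z assume "z \<in> U"
      then show "z \<in> {z \<in> ball 0 1. is_disk (fiber_space X fst z) (fiber_atlas X \<A> fst z)}"
        using disk U_sub by blast
    next
      fix z assume "z \<in> {z \<in> ball 0 1. is_disk (fiber_space X fst z) (fiber_atlas X \<A> fst z)}"
      then show "z \<in> U" using not_disk by blast
    qed
    show "U \<noteq> {}" "open U" "0 \<in> frontier U" by (simp_all add: U_def frontier_def)
  next
    fix \<gamma>\<^sub>0 a \<gamma>\<^sub>a
    assume circ: "circle_around_puncture (fiber_space X fst 0) (fiber_atlas X \<A> fst 0) \<gamma>\<^sub>0" and a: "a \<in> U"
    show "\<not> (\<exists>\<epsilon> f. 0 < \<epsilon> \<and> \<epsilon> < 1 \<and> foliated_map X \<A> fst \<epsilon> f \<and>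
            f ` ({0} \<times> ball 0 1) \<subseteq> fiber X fst a \<and> f ` ({1} \<times> sphere 0 1) \<subseteq> fiber X fst 0 \<and>
            homologous_rel 1 (fiber_space X fst 0) {} (loop_cycle (\<lambda>w. f (1, w))) (loop_cycle \<gamma>\<^sub>0))"
      using no_map[OF circ a] by (intro notI) (elim exE conjE)
  qed
qed

end
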